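(* Let $\ell_n=n^s$ with $s>0.5$ and assume there exists $\delta>0$ such that $\sum_{k=1}^\infty\alpha_Y(k)^{\delta/(2+\delta)}<\infty$ and $\mathbb{E}(|Y_1|^{4+2\delta})<\infty$. Then, under the hypothesis that $\mu$ is constant (there is $\mu_H\in\mathbb{R}$ with $\mu(x)=\mu_H$ for almost all $x\in[0,1]$), $$\sqrt{b_n}\left|\frac1{b_n(b_n-1)}\sum_{1\le j\ne k\le b_n}\sqrt{\hat\sigma_{j,n}^2+\hat\sigma_{k,n}^2}-\int_0^1\int_0^1\sqrt{\sigma^2(x)+\sigma^2(y)}\,\mathrm{d}x\,\mathrm{d}y\right|\longrightarrow0\quad\text{in }L^1\text{ as }n\to\infty .$$
   Context: $(Y_i)_{i\in\mathbb{N}}$ is a strictly stationary real-valued process with $\mathbb{E}(Y_1)=0$, $\mathrm{Var}(Y_1)=1$. For $\sigma$-fields $\mathcal{A},\mathcal{B}$ let $\alpha(\mathcal{A},\mathcal{B})=\sup\{|\mathbb{P}(A)\mathbb{P}(B)-\mathbb{P}(A\cap B)|:A\in\mathcal{A},B\in\mathcal{B}\}$ and $\alpha_Y(k)=\sup_{m\in\mathbb{N}}\alpha(\sigma(Y_1,\dots,Y_m),\sigma(Y_{k+m},Y_{k+m+1},\dots))$; $(Y_i)$ is $\alpha$-mixing, i.e. $\alpha_Y(k)\to0$. The long run variance $\kappa_Y^2=\mathrm{Var}(Y_1)+2\sum_{k=1}^\infty\mathrm{Cov}(Y_1,Y_{k+1})$ (finite under the moment and mixing assumptions made) satisfies $\kappa_Y^2>0$.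 Observations: $X_i=X_{i,n}=\mu(i/n)+\sigma(i/n)Y_i$, $i=1,\dots,n$, where $\mu:[0,1]\to\mathbb{R}$ is càdlàg and $\sigma:[0,1]\to(0,\infty)$ is càdlàg and piecewise Lipschitz-continuous (the sum of a Lipschitz-continuous function and a piecewise constant function with a fixed finite number of jumps), with $\sigma(x)\ge\sigma_0$ for all $x\in[0,1]$ and some $\sigma_0>0$. Blocks: $\ell_n=n^s$, $b_n=n^{1-s}$ with $s\in(0.5,1)$, both assumed to be integers; local means $\hat\mu_j=\frac1{\ell_n}\sum_{i=(j-1)\ell_n+1}^{j\ell_n}X_i$ and local variances $\hat\sigma_{j,n}^2=\frac1{\ell_n}\sum_{i=(j-1)\ell_n+1}^{j\ell_n}(X_i-\hat\mu_j)^2$, $1\le j\le b_n$. *)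

theory Defs
  imports "HOL-Probability.Probability"
begin

text \<open>
  The process is \<open>Y :: nat \<Rightarrow> 'a \<Rightarrow> real\<close> on a probability space \<open>M\<close>, with time indices
  \<open>1, 2, \<dots>\<close>; the value \<open>Y 0\<close> is never used.
\<close>

definition strictly_stationary :: "'a measure \<Rightarrow> (nat \<Rightarrow> 'a \<Rightarrow> real) \<Rightarrow> bool" where
  "strictly_stationary M Y \<longleftrightarrow>
     (\<forall>J h. finite J \<and> J \<subseteq> {1..} \<longrightarrow>
        distr M (Pi\<^sub>M J (\<lambda>_. borel)) (\<lambda>\<omega>. \<lambda>i\<in>J. Y (i + h) \<omega>)
        = distr M (Pi\<^sub>M J (\<lambda>_. borel)) (\<lambda>\<omega>. \<lambda>i\<in>J. Y i \<omega>))"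

definition generated_sigma :: "'a measure \<Rightarrow> (nat \<Rightarrow> 'a \<Rightarrow> real) \<Rightarrow> nat set \<Rightarrow> 'a set set" where
  "generated_sigma M Y I =
     sigma_sets (space M) {Y i -` B \<inter> space M | i B. i \<in> I \<and> B \<in> sets borel}"

definition alpha_coeff :: "'a measure \<Rightarrow> 'a set set \<Rightarrow> 'a set set \<Rightarrow> real" where
  "alpha_coeff M \<A> \<B> =
     Sup {\<bar>measure M A * measure M B - measure M (A \<inter> B)\<bar> | A B. A \<in> \<A> \<and> B \<in> \<B>}"

definition alpha_mix :: "'a measure \<Rightarrow> (nat \<Rightarrow> 'a \<Rightarrow> real) \<Rightarrow> nat \<Rightarrow> real" where
  "alpha_mix M Y k =
     (SUP m\<in>{1..}. alpha_coeff M (generated_sigma M Y {1..m}) (generated_sigma M Y {k + m..}))"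

definition covariance :: "'a measure \<Rightarrow> ('a \<Rightarrow> real) \<Rightarrow> ('a \<Rightarrow> real) \<Rightarrow> real" where
  "covariance M U V =
     (\<integral>\<omega>. (U \<omega> - (\<integral>\<omega>'. U \<omega>' \<partial>M)) * (V \<omega> - (\<integral>\<omega>'. V \<omega>' \<partial>M)) \<partial>M)"

definition long_run_variance :: "'a measure \<Rightarrow> (nat \<Rightarrow> 'a \<Rightarrow> real) \<Rightarrow> real" where
  "long_run_variance M Y =
     covariance M (Y 1) (Y 1) + 2 * (\<Sum>k. covariance M (Y 1) (Y (Suc k + 1)))"

text \<open>Functions on \<open>[0,1]\<close> are total functions whose values outside \<open>[0,1]\<close> are irrelevant.\<close>

definition cadlag01 :: "(real \<Rightarrow> real) \<Rightarrow> bool" where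
  "cadlag01 f \<longleftrightarrow>
     (\<forall>x\<in>{0..<1}. (f \<longlongrightarrow> f x) (at_right x)) \<and>
     (\<forall>x\<in>{0<..1}. \<exists>l. (f \<longlongrightarrow> l) (at_left x))"

text \<open>\<open>T\<close> is the finite set of possible jump points.\<close>

definition piecewise_constant01 :: "(real \<Rightarrow> real) \<Rightarrow> bool" where
  "piecewise_constant01 h \<longleftrightarrow>
     (\<exists>T. finite T \<and> (\<forall>x\<in>{0..1}. \<forall>y\<in>{0..1}. x \<le> y \<and> {x..y} \<inter> T = {} \<longrightarrow> h x = h y))"

definition piecewise_lipschitz01 :: "(real \<Rightarrow> real) \<Rightarrow> bool" where
  "piecewise_lipschitz01 f \<longleftrightarrow>
     (\<exists>g h. (\<exists>L. L-lipschitz_on {0..1} g) \<and> piecewise_constant01 h \<and>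
            (\<forall>x\<in>{0..1}. f x = g x + h x))"

definition obs ::
  "(real \<Rightarrow> real) \<Rightarrow> (real \<Rightarrow> real) \<Rightarrow> (nat \<Rightarrow> 'a \<Rightarrow> real) \<Rightarrow> nat \<Rightarrow> 'a \<Rightarrow> nat \<Rightarrow> real" where
  "obs \<mu> \<sigma> Y n \<omega> i = \<mu> (real i / real n) + \<sigma> (real i / real n) * Y i \<omega>"

text \<open>
  Sample sizes for which \<open>n\<^sup>s\<close> and \<open>n\<^sup>1\<^sup>-\<^sup>s\<close> are integers; limits \<open>n \<rightarrow> \<infinity>\<close> are taken along them.
  For such \<open>n\<close> the floors below are exact.
\<close>

definition admissible :: "real \<Rightarrow> nat set" where
  "admissible s = {n. real n powr s \<in> \<nat> \<and> real n powr (1 - s) \<in> \<nat>}"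

definition block_length :: "real \<Rightarrow> nat \<Rightarrow> nat" where
  "block_length s n = nat \<lfloor>real n powr s\<rfloor>"

definition block_number :: "real \<Rightarrow> nat \<Rightarrow> nat" where
  "block_number s n = nat \<lfloor>real n powr (1 - s)\<rfloor>"

definition local_mean :: "nat \<Rightarrow> (nat \<Rightarrow> real) \<Rightarrow> nat \<Rightarrow> real" where
  "local_mean l x j = (1 / real l) * (\<Sum>i\<in>{(j - 1) * l + 1..j * l}. x i)"

definition local_var :: "nat \<Rightarrow> (nat \<Rightarrow> real) \<Rightarrow> nat \<Rightarrow> real" where
  "local_var l x j =
     (1 / real l) * (\<Sum>i\<in>{(j - 1) * l + 1..j * l}. (x i - local_mean l x j)\<^sup>2)"

definition pair_stat :: "nat \<Rightarrow> nat \<Rightarrow> (nat \<Rightarrow> real) \<Rightarrow> real" where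
  "pair_stat b l x =
     1 / (real b * (real b - 1)) *
     (\<Sum>(j, k)\<in>{(j, k). j \<in> {1..b} \<and> k \<in> {1..b} \<and> j \<noteq> k}.
        sqrt (local_var l x j + local_var l x k))"

text \<open>
  Integrability is demanded explicitly because the Bochner integral of a non-integrable
  function is \<open>0\<close>.
\<close>

definition tendsto_zero_L1 ::
  "'a measure \<Rightarrow> (nat \<Rightarrow> 'a \<Rightarrow> real) \<Rightarrow> nat filter \<Rightarrow> bool" where
  "tendsto_zero_L1 M Z F \<longleftrightarrow>
     (\<forall>\<^sub>F n in F. integrable M (Z n)) \<and> ((\<lambda>n. \<integral>\<omega>. \<bar>Z n \<omega>\<bar> \<partial>M) \<longlongrightarrow> 0) F"

end

theory Submission
  imports Defs
begin

text \<open>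
  No central limit theorem or decoupling between blocks is needed, because \<open>s > 1/2\<close> leaves room for
  a first-order bound. Let \<open>v\<^sub>j\<close> be the average of \<open>\<sigma>\<^sup>2(i/n)\<close> over the \<open>j\<close>-th block. Since \<open>v\<^sub>j\<close> is
  bounded below, \<open>sqrt\<close> is Lipschitz on the relevant range, so replacing every local variance by \<open>v\<^sub>j\<close>
  costs at most a constant times the mean of their distances to \<open>v\<^sub>j\<close>. Davydov's covariance inequality and
  summability of the mixing coefficients give these distances expectation \<open>O(1 / sqrt \<ell>)\<close>. The remaining
  deterministic Riemann-type sum differs from the double integral by \<open>O(1 / b)\<close>, because all but
  boundedly many blocks are free of jumps of \<open>\<sigma>\<close>. After multiplication by \<open>sqrt b\<close> both errors,
  of order \<open>n powr (1/2 - s)\<close> and \<open>n powr ((s - 1)/2)\<close>, vanish.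
\<close>

section \<open>Covariance inequalities for mixing random variables\<close>

text \<open>The local variances may come arbitrarily close to zero, so the square root is compared
  using a lower bound on one argument only, which \<open>v\<^sub>j\<close> supplies. The rate
  \<open>1 / sqrt l\<close> is that of the block average of
  \<open>\<sigma>\<^sup>2 * (Y\<^sup>2 - 1)\<close>; the squared block mean has the smaller order
  \<open>1 / l\<close>. The covariance inequality asks for a moment of order
  \<open>2 + \<delta>\<close>, and for \<open>Y\<^sup>2 - 1\<close> this becomes the moment of order
  \<open>4 + 2 * \<delta>\<close> of \<open>Y 1\<close>. The function \<mu> is constant only almost
  everywhere: right continuity makes it constant on \<open>[0,1)\<close>, while the observation at
  the end point \<open>1\<close> may have another mean. It is carried along as a perturbation
  \<open>d\<close> whose total mass in each block is bounded. All estimates hold for free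
  \<open>b\<close> and \<open>l\<close> with sample size \<open>b * l\<close>; powers of
  \<open>n\<close> enter only at the end.\<close>

lemma sum_le_indicator_eq_floor:
  assumes "0 \<le> u" "u \<le> real N"
  shows "(\<Sum>j\<in>{1..N}. if real j \<le> u then 1 else 0 :: real) = of_int \<lfloor>u\<rfloor>"
proof -
  have "{j \<in> {1..N}. real j \<le> u} = {1..nat \<lfloor>u\<rfloor>}"
    using assms by (auto simp: le_nat_floor) linarith+
  then have "(\<Sum>j\<in>{1..N}. if real j \<le> u then 1 else 0 :: real) = real (nat \<lfloor>u\<rfloor>)"
    by (simp add: sum.If_cases Int_def)
  then show ?thesis using assms by simp
qed

text \<open>Up to the factor \<open>c / N\<close>, \<open>y\<close> counts the grid points
  \<open>j * c / N\<close> with \<open>j \<ge> 1\<close> that do not exceed \<open>x\<close>, so it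
  is \<open>x\<close> rounded down to a grid of mesh \<open>c / N\<close>; by
  \<open>x \<le> c\<close> no such grid point is missing from \<open>{1..N}\<close>.\<close>

lemma level_sum_approx:
  fixes c x :: real
  assumes "c > 0" "0 \<le> x" "x \<le> c" "N \<ge> 1"
  defines "y \<equiv> c / N * (\<Sum>j\<in>{1..N}. if real j * c / N \<le> x then 1 else 0)"
  shows "0 \<le> y" "y \<le> x" "x - y \<le> c / N"
proof -
  have "(\<Sum>j\<in>{1..N}. if real j * c / N \<le> x then 1 else 0 :: real)
      = (\<Sum>j\<in>{1..N}. if real j \<le> x * N / c then 1 else 0)"
    using assms by (intro sum.cong) (auto simp: field_simps)
  also have "\<dots> = of_int \<lfloor>x * N / c\<rfloor>"
    using assms by (intro sum_le_indicator_eq_floor) (auto simp: field_simps)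
  finally have y: "y = c / N * of_int \<lfloor>x * N / c\<rfloor>" by (simp add: y_def)
  have *: "of_int \<lfloor>x * N / c\<rfloor> \<le> x * N / c" "x * N / c - 1 \<le> of_int \<lfloor>x * N / c\<rfloor>"
    by linarith+
  have "0 \<le> c / N * of_int \<lfloor>x * N / c\<rfloor>" using assms by simp
  then show "0 \<le> y" by (simp only: y)
  have "c / N * of_int \<lfloor>x * N / c\<rfloor> \<le> c / N * (x * N / c)"
    using assms * by (intro mult_left_mono) auto
  also have "\<dots> = x" using assms by simp
  finally show "y \<le> x" by (simp only: y)
  have "x - c / N = c / N * (x * N / c - 1)" using assms by (simp add: algebra_simps)
  also have "\<dots> \<le> c / N * of_int \<lfloor>x * N / c\<rfloor>"
    using assms * by (intro mult_left_mono) auto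
  finally show "x - y \<le> c / N" by (simp only: y)
qed

text \<open>Replacing both variables by Riemann sums of the layer-cake formula turns their covariance
  into an average of \<open>P(X \<ge> s, Y \<ge> t) - P(X \<ge> s) P(Y \<ge> t)\<close>.\<close>

lemma (in prob_space) cov_bound_nonneg:
  fixes X Y :: "'a \<Rightarrow> real"
  assumes [measurable]: "X \<in> borel_measurable M" "Y \<in> borel_measurable M"
    and c: "c > 0"
    and X: "\<And>\<omega>. \<omega> \<in> space M \<Longrightarrow> 0 \<le> X \<omega> \<and> X \<omega> \<le> c"
    and Y: "\<And>\<omega>. \<omega> \<in> space M \<Longrightarrow> 0 \<le> Y \<omega> \<and> Y \<omega> \<le> c"
    and a: "\<And>s t. \<bar>prob {\<omega>\<in>space M. s \<le> X \<omega>} * prob {\<omega>\<in>space M. t \<le> Y \<omega>}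
               - prob {\<omega>\<in>space M. s \<le> X \<omega> \<and> t \<le> Y \<omega>}\<bar> \<le> a"
  shows "\<bar>expectation (\<lambda>\<omega>. X \<omega> * Y \<omega>) - expectation X * expectation Y\<bar> \<le> c\<^sup>2 * a"
proof -
  \<comment> \<open>Discretising costs \<open>2 * c\<^sup>2 / N\<close> in the mean of the product
    and the same in the product of the means: each time, two terms pair a factor of size at most
    \<open>c\<close> with a rounding error of at most \<open>c / N\<close>. The total
    \<open>4 * c\<^sup>2 / N\<close> disappears as \<open>N\<close> grows.\<close>
  have step: "\<bar>expectation (\<lambda>\<omega>. X \<omega> * Y \<omega>) - expectation X * expectation Y\<bar>
      \<le> c\<^sup>2 * a + 4 * c\<^sup>2 / N" if N: "N \<ge> 1" for N :: nat
  proof -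
    define D where "D U \<omega> = c / N * (\<Sum>j\<in>{1..N}. if real j * c / N \<le> U \<omega> then 1 else 0)"
      for U :: "'a \<Rightarrow> real" and \<omega>
    have D_meas [measurable]: "D U \<in> borel_measurable M" if [measurable]: "U \<in> borel_measurable M" for U
      unfolding D_def by measurable
    note DX = level_sum_approx[OF c _ _ N, of "X _", folded D_def]
    note DY = level_sum_approx[OF c _ _ N, of "Y _", folded D_def]
    have bX: "0 \<le> D X \<omega>" "D X \<omega> \<le> X \<omega>" "X \<omega> - D X \<omega> \<le> c / N" "0 \<le> X \<omega>" "X \<omega> \<le> c" "D X \<omega> \<le> c"
      and bY: "0 \<le> D Y \<omega>" "D Y \<omega> \<le> Y \<omega>" "Y \<omega> - D Y \<omega> \<le> c / N" "0 \<le> Y \<omega>" "Y \<omega> \<le> c" "D Y \<omega> \<le> c"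
      if "\<omega> \<in> space M" for \<omega>
      using DX[of \<omega>] DY[of \<omega>] X[OF that] Y[OF that] by auto
    have int: "integrable M U" if "U \<in> borel_measurable M"
      "\<And>\<omega>. \<omega> \<in> space M \<Longrightarrow> \<bar>U \<omega>\<bar> \<le> B" for U :: "'a \<Rightarrow> real" and B
      using that by (intro integrable_const_bound[where B = B]) auto
    have iX: "integrable M X" by (rule int[of _ c]) (use bX in auto)
    have iY: "integrable M Y" by (rule int[of _ c]) (use bY in auto)
    have iDX: "integrable M (D X)" by (rule int[of _ c]) (use bX in auto)
    have iDY: "integrable M (D Y)" by (rule int[of _ c]) (use bY in auto)
    have iXY: "integrable M (\<lambda>\<omega>. X \<omega> * Y \<omega>)"
      by (rule int[of _ "c * c"]) (use bX bY c in \<open>auto simp: abs_mult intro!: mult_mono\<close>)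
    have iDXY: "integrable M (\<lambda>\<omega>. D X \<omega> * D Y \<omega>)"
      by (rule int[of _ "c * c"])
        (use bX bY c in \<open>auto simp: abs_mult intro!: mult_mono\<close>)
    have "\<bar>expectation (\<lambda>\<omega>. X \<omega> * Y \<omega>) - expectation (\<lambda>\<omega>. D X \<omega> * D Y \<omega>)\<bar>
        = \<bar>expectation (\<lambda>\<omega>. X \<omega> * Y \<omega> - D X \<omega> * D Y \<omega>)\<bar>"
      using iXY iDXY by simp
    also have "\<dots> \<le> 2 * c\<^sup>2 / N"
    proof (intro abs_leI)
      have b: "0 \<le> X \<omega> * Y \<omega> - D X \<omega> * D Y \<omega>" "X \<omega> * Y \<omega> - D X \<omega> * D Y \<omega> \<le> 2 * c\<^sup>2 / N"
        if "\<omega> \<in> space M" for \<omega>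
      proof -
        show "0 \<le> X \<omega> * Y \<omega> - D X \<omega> * D Y \<omega>"
          using bX[OF that] bY[OF that] by (simp add: mult_mono)
        have "X \<omega> * Y \<omega> - D X \<omega> * D Y \<omega> = X \<omega> * (Y \<omega> - D Y \<omega>) + D Y \<omega> * (X \<omega> - D X \<omega>)"
          by (simp add: algebra_simps)
        also have "\<dots> \<le> c * (c / N) + c * (c / N)"
          using bX[OF that] bY[OF that] c by (intro add_mono mult_mono) auto
        finally show "X \<omega> * Y \<omega> - D X \<omega> * D Y \<omega> \<le> 2 * c\<^sup>2 / N" by (simp add: power2_eq_square)
      qed
      show "expectation (\<lambda>\<omega>. X \<omega> * Y \<omega> - D X \<omega> * D Y \<omega>) \<le> 2 * c\<^sup>2 / N"
        using iXY iDXY b by (intro integral_le_const) auto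
      have "0 \<le> expectation (\<lambda>\<omega>. X \<omega> * Y \<omega> - D X \<omega> * D Y \<omega>)"
        using b by (intro integral_nonneg_AE) auto
      moreover have "0 \<le> 2 * c\<^sup>2 / N" by simp
      ultimately show "- expectation (\<lambda>\<omega>. X \<omega> * Y \<omega> - D X \<omega> * D Y \<omega>) \<le> 2 * c\<^sup>2 / N" by linarith
    qed
    finally have 1: "\<bar>expectation (\<lambda>\<omega>. X \<omega> * Y \<omega>) - expectation (\<lambda>\<omega>. D X \<omega> * D Y \<omega>)\<bar>
      \<le> 2 * c\<^sup>2 / N" .
    have eX: "0 \<le> expectation (D X)" "expectation (D X) \<le> expectation X"
       "expectation X - expectation (D X) \<le> c / N" "0 \<le> expectation X" "expectation X \<le> c"
    proof -
      show "0 \<le> expectation (D X)" "0 \<le> expectation X" 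
        using bX by (auto intro!: integral_nonneg_AE)
      show "expectation (D X) \<le> expectation X"
        using bX iX iDX by (intro integral_mono) auto
      show "expectation X \<le> c"
        using bX iX by (intro integral_le_const) auto
      have "expectation X - expectation (D X) = expectation (\<lambda>\<omega>. X \<omega> - D X \<omega>)"
        using iX iDX by simp
      also have "\<dots> \<le> c / N" using bX iX iDX by (intro integral_le_const) auto
      finally show "expectation X - expectation (D X) \<le> c / N" .
    qed
    have eY: "0 \<le> expectation (D Y)" "expectation (D Y) \<le> expectation Y"
       "expectation Y - expectation (D Y) \<le> c / N" "0 \<le> expectation Y" "expectation Y \<le> c"
    proof -
      show "0 \<le> expectation (D Y)" "0 \<le> expectation Y" 
        using bY by (auto intro!: integral_nonneg_AE)
      show "expectation (D Y) \<le> expectation Y"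
        using bY iY iDY by (intro integral_mono) auto
      show "expectation Y \<le> c"
        using bY iY by (intro integral_le_const) auto
      have "expectation Y - expectation (D Y) = expectation (\<lambda>\<omega>. Y \<omega> - D Y \<omega>)"
        using iY iDY by simp
      also have "\<dots> \<le> c / N" using bY iY iDY by (intro integral_le_const) auto
      finally show "expectation Y - expectation (D Y) \<le> c / N" .
    qed
    have 2: "\<bar>expectation X * expectation Y - expectation (D X) * expectation (D Y)\<bar> \<le> 2 * c\<^sup>2 / N"
    proof -
      have "0 \<le> expectation X * expectation Y - expectation (D X) * expectation (D Y)"
        using eX eY by (simp add: mult_mono)
      moreover have "expectation X * expectation Y - expectation (D X) * expectation (D Y)
        = expectation X * (expectation Y - expectation (D Y))
          + expectation (D Y) * (expectation X - expectation (D X))" by (simp add: algebra_simps)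
      moreover have "\<dots> \<le> c * (c / N) + c * (c / N)"
        using eX eY c by (intro add_mono mult_mono) auto
      ultimately show ?thesis by (simp add: power2_eq_square)
    qed
    let ?q = "\<lambda>j. real j * c / N"
    let ?A = "\<lambda>U j. {\<omega>\<in>space M. ?q j \<le> U \<omega>}"
    have eD: "expectation (D U) = c / N * (\<Sum>j\<in>{1..N}. prob (?A U j))"
      if [measurable]: "U \<in> borel_measurable M" for U
    proof -
      have "expectation (D U) = expectation (\<lambda>\<omega>. c / N * (\<Sum>j\<in>{1..N}. indicator (?A U j) \<omega>))"
        unfolding D_def by (intro Bochner_Integration.integral_cong refl arg_cong2[where f="(*)"] sum.cong)
           (auto simp: indicator_def)
      also have "\<dots> = c / N * (\<Sum>j\<in>{1..N}. expectation (indicator (?A U j)))"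
        by (subst integral_mult_right_zero, subst Bochner_Integration.integral_sum)
          (auto intro!: integrable_real_indicator simp: less_top[symmetric])
      finally show ?thesis by simp
    qed
    have "expectation (\<lambda>\<omega>. D X \<omega> * D Y \<omega>) =
        expectation (\<lambda>\<omega>. (c / N)\<^sup>2 * (\<Sum>j\<in>{1..N}. \<Sum>k\<in>{1..N}.
          indicator {\<omega>\<in>space M. ?q j \<le> X \<omega> \<and> ?q k \<le> Y \<omega>} \<omega>))"
    proof (intro Bochner_Integration.integral_cong refl)
      fix \<omega> assume "\<omega> \<in> space M"
      have "D X \<omega> * D Y \<omega> = (c / N)\<^sup>2 * ((\<Sum>j\<in>{1..N}. if ?q j \<le> X \<omega> then 1 else 0) *
         (\<Sum>j\<in>{1..N}. if ?q j \<le> Y \<omega> then 1 else 0))"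
        by (simp add: D_def power2_eq_square)
      also have "\<dots> = (c / N)\<^sup>2 * (\<Sum>j\<in>{1..N}. \<Sum>k\<in>{1..N}.
          indicator {\<omega>\<in>space M. ?q j \<le> X \<omega> \<and> ?q k \<le> Y \<omega>} \<omega>)"
        unfolding sum_product using \<open>\<omega> \<in> space M\<close>
        by (intro arg_cong2[where f="(*)"] refl sum.cong) (auto simp: indicator_def)
      finally show "D X \<omega> * D Y \<omega> = \<dots>" .
    qed
    also have "\<dots> = (c / N)\<^sup>2 * (\<Sum>j\<in>{1..N}. \<Sum>k\<in>{1..N}.
        prob {\<omega>\<in>space M. ?q j \<le> X \<omega> \<and> ?q k \<le> Y \<omega>})"
      by (simp add: integrable_real_indicator less_top[symmetric])
    finally have eDD: "expectation (\<lambda>\<omega>. D X \<omega> * D Y \<omega>) = \<dots>" .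
    \<comment> \<open>By bilinearity this covariance is a sum of \<open>N * N\<close> probability
      differences, each at most \<open>a\<close> in absolute value and weighted by
      \<open>(c / N)\<^sup>2\<close>; the powers of \<open>N\<close> cancel.\<close>
    have "expectation (\<lambda>\<omega>. D X \<omega> * D Y \<omega>) - expectation (D X) * expectation (D Y) =
      (c / N)\<^sup>2 * (\<Sum>j\<in>{1..N}. \<Sum>k\<in>{1..N}. 
         prob {\<omega>\<in>space M. ?q j \<le> X \<omega> \<and> ?q k \<le> Y \<omega>} - prob (?A X j) * prob (?A Y k))"
      by (simp add: eDD eD sum_subtractf sum_product[symmetric] power2_eq_square algebra_simps)
    also have "\<bar>\<dots>\<bar> \<le> (c / N)\<^sup>2 * (\<Sum>j\<in>{1..N}. \<Sum>k\<in>{1..N}. a)"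
      unfolding abs_mult abs_power2
      by (intro mult_left_mono order_trans[OF sum_abs] sum_mono)
        (use a in \<open>auto simp: abs_minus_commute\<close>)
    also have "\<dots> = c\<^sup>2 * a" using N by (simp add: power2_eq_square)
    finally show ?thesis using 1 2 by linarith
  qed
  have "(\<lambda>N. c\<^sup>2 * a + 4 * c\<^sup>2 / real N) \<longlonglongrightarrow> c\<^sup>2 * a + 0"
    by (intro tendsto_intros tendsto_divide_0[OF tendsto_const] filterlim_compose[OF filterlim_real_sequentially]
       filterlim_at_top_imp_at_infinity) (auto simp: filterlim_ident filterlim_real_sequentially)
  then show ?thesis
    by (intro LIMSEQ_le_const[where X="\<lambda>N. c\<^sup>2 * a + 4 * c\<^sup>2 / real N"])
      (use step in \<open>auto intro!: exI[of _ 1]\<close>)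
qed

text \<open>Adding \<open>c\<close> to both variables leaves the covariance and the family of level
  events unchanged and moves the values into \<open>[0, 2 * c]\<close>; the factor \<open>4\<close>
  is the square of that doubling.\<close>

lemma (in prob_space) cov_bound_bounded:
  fixes X Y :: "'a \<Rightarrow> real"
  assumes [measurable]: "X \<in> borel_measurable M" "Y \<in> borel_measurable M"
    and c: "c > 0"
    and X: "\<And>\<omega>. \<omega> \<in> space M \<Longrightarrow> \<bar>X \<omega>\<bar> \<le> c"
    and Y: "\<And>\<omega>. \<omega> \<in> space M \<Longrightarrow> \<bar>Y \<omega>\<bar> \<le> c"
    and a: "\<And>s t. \<bar>prob {\<omega>\<in>space M. s \<le> X \<omega>} * prob {\<omega>\<in>space M. t \<le> Y \<omega>}
               - prob {\<omega>\<in>space M. s \<le> X \<omega> \<and> t \<le> Y \<omega>}\<bar> \<le> a"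
  shows "\<bar>expectation (\<lambda>\<omega>. X \<omega> * Y \<omega>) - expectation X * expectation Y\<bar> \<le> 4 * c\<^sup>2 * a"
proof -
  have iX: "integrable M X" and iY: "integrable M Y"
    using X Y by (auto intro!: integrable_const_bound[where B = c])
  have iXY: "integrable M (\<lambda>\<omega>. X \<omega> * Y \<omega>)"
    using X Y c by (intro integrable_const_bound[where B = "c * c"])
      (auto simp: abs_mult intro!: mult_mono)
  have "\<bar>expectation (\<lambda>\<omega>. (X \<omega> + c) * (Y \<omega> + c))
       - expectation (\<lambda>\<omega>. X \<omega> + c) * expectation (\<lambda>\<omega>. Y \<omega> + c)\<bar> \<le> (2 * c)\<^sup>2 * a"
  proof (rule cov_bound_nonneg)
    show "0 \<le> X \<omega> + c \<and> X \<omega> + c \<le> 2 * c" "0 \<le> Y \<omega> + c \<and> Y \<omega> + c \<le> 2 * c"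
      if "\<omega> \<in> space M" for \<omega> using X[OF that] Y[OF that] by auto
    show "\<bar>prob {\<omega>\<in>space M. s \<le> X \<omega> + c} * prob {\<omega>\<in>space M. t \<le> Y \<omega> + c}
               - prob {\<omega>\<in>space M. s \<le> X \<omega> + c \<and> t \<le> Y \<omega> + c}\<bar> \<le> a" for s t
      using a[of "s - c" "t - c"] by (simp add: diff_le_eq)
  qed (use c in auto)
  moreover have "expectation (\<lambda>\<omega>. (X \<omega> + c) * (Y \<omega> + c))
       - expectation (\<lambda>\<omega>. X \<omega> + c) * expectation (\<lambda>\<omega>. Y \<omega> + c)
     = expectation (\<lambda>\<omega>. X \<omega> * Y \<omega>) - expectation X * expectation Y"
  proof -
    have "expectation (\<lambda>\<omega>. (X \<omega> + c) * (Y \<omega> + c))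
       = expectation (\<lambda>\<omega>. X \<omega> * Y \<omega> + c * X \<omega> + c * Y \<omega> + c * c)"
      by (intro Bochner_Integration.integral_cong) (auto simp: algebra_simps)
    then show ?thesis using iX iY iXY by (simp add: prob_space algebra_simps)
  qed
  ultimately show ?thesis by (simp add: power_mult_distrib)
qed

section \<open>Truncation and moment bounds for the remainder\<close>

definition clip :: "real \<Rightarrow> real \<Rightarrow> real" where
  "clip c x = max (- c) (min c x)"

lemma clip_measurable [measurable]: "clip c \<in> borel_measurable borel"
  unfolding clip_def by measurable

lemma abs_clip_le: "c \<ge> 0 \<Longrightarrow> \<bar>clip c x\<bar> \<le> c"
  by (auto simp: clip_def)

lemma abs_clip_le_abs: "c \<ge> 0 \<Longrightarrow> \<bar>clip c x\<bar> \<le> \<bar>x\<bar>"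
  by (auto simp: clip_def)

text \<open>Powers are traded as in Markov's inequality: the remainder vanishes for
  \<open>\<bar>x\<bar> \<le> c\<close>, and beyond \<open>c\<close> it is at most
  \<open>\<bar>x\<bar>\<close>, where a negative power of \<open>\<bar>x\<bar>\<close> is dominated
  by the same power of \<open>c\<close>.\<close>

lemma abs_diff_clip_le:
  assumes "c \<ge> 1" "\<delta> > 0"
  shows "\<bar>x - clip c x\<bar> \<le> c powr (- 1 - \<delta>) * \<bar>x\<bar> powr (2 + \<delta>)"
    and "(x - clip c x)\<^sup>2 \<le> c powr (- \<delta>) * \<bar>x\<bar> powr (2 + \<delta>)"
proof -
  have "\<bar>x - clip c x\<bar> \<le> c powr (- 1 - \<delta>) * \<bar>x\<bar> powr (2 + \<delta>) \<and>
        (x - clip c x)\<^sup>2 \<le> c powr (- \<delta>) * \<bar>x\<bar> powr (2 + \<delta>)"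
  proof (cases "\<bar>x\<bar> \<le> c")
    case True
    then have "clip c x = x" by (auto simp: clip_def)
    then show ?thesis by simp
  next
    case False
    have le: "\<bar>x - clip c x\<bar> \<le> \<bar>x\<bar>" using assms by (auto simp: clip_def)
    have x: "\<bar>x\<bar> > 0" using False assms by auto
    have "\<bar>x\<bar> = \<bar>x\<bar> powr (- 1 - \<delta>) * \<bar>x\<bar> powr (2 + \<delta>)"
      using x by (simp add: powr_add[symmetric])
    also have "\<dots> \<le> c powr (- 1 - \<delta>) * \<bar>x\<bar> powr (2 + \<delta>)"
      using False assms by (intro mult_right_mono powr_mono2') auto
    finally have 1: "\<bar>x\<bar> \<le> c powr (- 1 - \<delta>) * \<bar>x\<bar> powr (2 + \<delta>)" .
    have "\<bar>x\<bar> powr 2 = \<bar>x\<bar> powr (- \<delta>) * \<bar>x\<bar> powr (2 + \<delta>)"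
      using x by (simp add: powr_add[symmetric] del: powr_numeral)
    also have "\<dots> \<le> c powr (- \<delta>) * \<bar>x\<bar> powr (2 + \<delta>)"
      using False assms by (intro mult_right_mono powr_mono2') auto
    finally have 2: "x\<^sup>2 \<le> c powr (- \<delta>) * \<bar>x\<bar> powr (2 + \<delta>)" using x by simp
    have "(x - clip c x)\<^sup>2 \<le> x\<^sup>2" using le by (simp add: abs_le_square_iff)
    then show ?thesis using le 1 2 by linarith
  qed
  then show "\<bar>x - clip c x\<bar> \<le> c powr (- 1 - \<delta>) * \<bar>x\<bar> powr (2 + \<delta>)"
    "(x - clip c x)\<^sup>2 \<le> c powr (- \<delta>) * \<bar>x\<bar> powr (2 + \<delta>)" by auto
qed

lemma abs_le_one_plus_powr:
  fixes x :: real
  assumes "p \<ge> 1"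
  shows "\<bar>x\<bar> \<le> 1 + \<bar>x\<bar> powr p"
proof (cases "\<bar>x\<bar> \<le> 1")
  case True
  then show ?thesis using powr_ge_zero[of "\<bar>x\<bar>" p] by linarith
next
  case False
  then show ?thesis using assms powr_mono[of 1 p "\<bar>x\<bar>"] by simp
qed

lemma square_le_one_plus_powr:
  fixes x :: real
  assumes "p \<ge> 2"
  shows "x\<^sup>2 \<le> 1 + \<bar>x\<bar> powr p"
proof (cases "\<bar>x\<bar> \<le> 1")
  case True
  then have "x\<^sup>2 \<le> 1" by (simp add: abs_square_le_1)
  then show ?thesis using powr_ge_zero[of "\<bar>x\<bar>" p] by linarith
next
  case False
  then have "\<bar>x\<bar> powr 2 \<le> \<bar>x\<bar> powr p" using assms by (intro powr_mono) auto
  then show ?thesis using False by (simp add: powr_numeral)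
qed

lemma abs_mult_le_sum_squares: "\<bar>x * y\<bar> \<le> (x\<^sup>2 + y\<^sup>2) / 2" for x y :: real
  using sum_squares_bound[of "\<bar>x\<bar>" "\<bar>y\<bar>"] by (simp add: abs_mult)

lemma (in prob_space) integrable_of_powr:
  fixes X :: "'a \<Rightarrow> real"
  assumes [measurable]: "X \<in> borel_measurable M" and "integrable M (\<lambda>\<omega>. \<bar>X \<omega>\<bar> powr p)"
  shows "p \<ge> 1 \<Longrightarrow> integrable M X" "p \<ge> 2 \<Longrightarrow> integrable M (\<lambda>\<omega>. (X \<omega>)\<^sup>2)"
proof -
  have i: "integrable M (\<lambda>\<omega>. 1 + \<bar>X \<omega>\<bar> powr p)" using assms by simp
  show "integrable M X" if "p \<ge> 1"
    by (rule Bochner_Integration.integrable_bound[OF i]) (use abs_le_one_plus_powr[OF that] in auto)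
  show "integrable M (\<lambda>\<omega>. (X \<omega>)\<^sup>2)" if "p \<ge> 2"
    by (rule Bochner_Integration.integrable_bound[OF i]) (use square_le_one_plus_powr[OF that] in auto)
qed

lemma (in prob_space) integrable_mult_of_squares:
  fixes X Y :: "'a \<Rightarrow> real"
  assumes [measurable]: "X \<in> borel_measurable M" "Y \<in> borel_measurable M"
    and "integrable M (\<lambda>\<omega>. (X \<omega>)\<^sup>2)" "integrable M (\<lambda>\<omega>. (Y \<omega>)\<^sup>2)"
  shows "integrable M (\<lambda>\<omega>. X \<omega> * Y \<omega>)"
  by (rule Bochner_Integration.integrable_bound[where f = "\<lambda>\<omega>. ((X \<omega>)\<^sup>2 + (Y \<omega>)\<^sup>2) / 2"])
    (use assms abs_mult_le_sum_squares in auto)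

text \<open>The truncated variables contribute \<open>4 * a * c\<^sup>2\<close>, the remainders a
  multiple of \<open>c powr (- \<delta>)\<close>. In its constant, \<open>3 * K\<close> comes from
  the mean of the product and \<open>2 * K + 2 * K\<^sup>2\<close> from the product of the means.
  The level \<open>c\<close> stays free so that it can be matched to \<open>a\<close>.\<close>

lemma (in prob_space) cov_bound_truncation:
  fixes X Y :: "'a \<Rightarrow> real"
  assumes [measurable]: "X \<in> borel_measurable M" "Y \<in> borel_measurable M"
    and \<delta>: "\<delta> > 0" and c: "c \<ge> 1"
    and iX: "integrable M (\<lambda>\<omega>. \<bar>X \<omega>\<bar> powr (2 + \<delta>))"
    and iY: "integrable M (\<lambda>\<omega>. \<bar>Y \<omega>\<bar> powr (2 + \<delta>))"
    and KX: "expectation (\<lambda>\<omega>. \<bar>X \<omega>\<bar> powr (2 + \<delta>)) \<le> K"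
    and KY: "expectation (\<lambda>\<omega>. \<bar>Y \<omega>\<bar> powr (2 + \<delta>)) \<le> K"
    and a: "\<And>A B. A \<in> sets borel \<Longrightarrow> B \<in> sets borel \<Longrightarrow>
             \<bar>prob {\<omega>\<in>space M. X \<omega> \<in> A} * prob {\<omega>\<in>space M. Y \<omega> \<in> B}
               - prob {\<omega>\<in>space M. X \<omega> \<in> A \<and> Y \<omega> \<in> B}\<bar> \<le> a"
  shows "\<bar>expectation (\<lambda>\<omega>. X \<omega> * Y \<omega>) - expectation X * expectation Y\<bar>
     \<le> 4 * a * c\<^sup>2 + (5 * K + 2 * K\<^sup>2) * c powr (- \<delta>)"
proof -
  let ?X1 = "\<lambda>\<omega>. clip c (X \<omega>)" and ?Y1 = "\<lambda>\<omega>. clip c (Y \<omega>)"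
  note c0 = order_trans[OF zero_le_one c]
  have K: "K \<ge> 0"
    by (rule order_trans[OF integral_nonneg_AE KX]) auto
  have p: "2 + \<delta> \<ge> 1" "2 + \<delta> \<ge> 2" using \<delta> by auto
  note int = integrable_of_powr(1)[OF _ iX p(1)] integrable_of_powr(1)[OF _ iY p(1)]
     integrable_mult_of_squares[OF _ _ integrable_of_powr(2)[OF _ iX p(2)] integrable_of_powr(2)[OF _ iY p(2)]]
  note int = int[simplified]
  have int1: "integrable M ?X1" "integrable M ?Y1" "integrable M (\<lambda>\<omega>. ?X1 \<omega> * ?Y1 \<omega>)"
    using abs_clip_le[OF c0] c0
    by (auto intro!: integrable_const_bound[of ?X1 c] integrable_const_bound[of ?Y1 c]
       integrable_const_bound[of "\<lambda>\<omega>. ?X1 \<omega> * ?Y1 \<omega>" "c * c"] AE_I2 mult_mono simp: abs_mult)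
  have bounded: "\<bar>expectation (\<lambda>\<omega>. ?X1 \<omega> * ?Y1 \<omega>) - expectation ?X1 * expectation ?Y1\<bar> \<le> 4 * c\<^sup>2 * a"
  proof (rule cov_bound_bounded)
    fix s t :: real
    \<comment> \<open>Level events of a truncated variable are events of the variable itself, so the
      assumption on arbitrary Borel sets covers them with the same \<open>a\<close>.\<close>
    have [measurable]: "{x. u \<le> clip c x} \<in> sets borel" for u by measurable
    show "\<bar>prob {\<omega>\<in>space M. s \<le> ?X1 \<omega>} * prob {\<omega>\<in>space M. t \<le> ?Y1 \<omega>}
               - prob {\<omega>\<in>space M. s \<le> ?X1 \<omega> \<and> t \<le> ?Y1 \<omega>}\<bar> \<le> a"
      using a[of "{x. s \<le> clip c x}" "{x. t \<le> clip c x}"] by simp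
  qed (use c0 c abs_clip_le in auto)
  let ?P = "\<lambda>U \<omega>. \<bar>U \<omega>\<bar> powr (2 + \<delta>)"
  have "\<bar>expectation (\<lambda>\<omega>. X \<omega> * Y \<omega>) - expectation (\<lambda>\<omega>. ?X1 \<omega> * ?Y1 \<omega>)\<bar>
      = \<bar>expectation (\<lambda>\<omega>. X \<omega> * Y \<omega> - ?X1 \<omega> * ?Y1 \<omega>)\<bar>"
    using int int1 by simp
  also have "\<dots> \<le> expectation (\<lambda>\<omega>. \<bar>X \<omega> * Y \<omega> - ?X1 \<omega> * ?Y1 \<omega>\<bar>)" by (rule integral_abs_bound)
  also have "\<dots> \<le> expectation (\<lambda>\<omega>. 3/2 * c powr (- \<delta>) * (?P X \<omega> + ?P Y \<omega>))"
  proof (rule integral_mono)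
    fix \<omega>
    let ?x = "X \<omega>" and ?y = "Y \<omega>"
    let ?x1 = "clip c ?x" and ?y1 = "clip c ?y"
    \<comment> \<open>In a cross term the bounded factor \<open>c\<close> meets a remainder of order
      \<open>c powr (- 1 - \<delta>)\<close>, which gives the order of the squared remainders. Each
      variable occurs once in a cross term and with weight one half in a square: hence the factor
      \<open>3 / 2\<close>.\<close>
    have cc: "c * c powr (- 1 - \<delta>) = c powr (- \<delta>)"
      using c by (subst powr_mult_base) auto
    have lin: "c * \<bar>x - clip c x\<bar> \<le> c powr (- \<delta>) * \<bar>x\<bar> powr (2 + \<delta>)" for x
      using mult_left_mono[OF abs_diff_clip_le(1)[OF c \<delta>, of x] c0] unfolding cc[symmetric]
      by (simp add: mult_ac)
    have "?x * ?y - ?x1 * ?y1 = ?x1 * (?y - ?y1) + ?y1 * (?x - ?x1) + (?x - ?x1) * (?y - ?y1)"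
      by (simp add: algebra_simps)
    also have "\<bar>\<dots>\<bar> \<le> \<bar>?x1\<bar> * \<bar>?y - ?y1\<bar> + \<bar>?y1\<bar> * \<bar>?x - ?x1\<bar> + \<bar>(?x - ?x1) * (?y - ?y1)\<bar>"
      unfolding abs_mult[symmetric] by linarith
    also have "\<dots> \<le> c * \<bar>?y - ?y1\<bar> + c * \<bar>?x - ?x1\<bar> + ((?x - ?x1)\<^sup>2 + (?y - ?y1)\<^sup>2) / 2"
      using abs_clip_le[OF c0] by (intro add_mono mult_right_mono abs_mult_le_sum_squares) auto
    also have "\<dots> \<le> 3/2 * c powr (- \<delta>) * (?P X \<omega> + ?P Y \<omega>)"
    proof -
      have arith: "b + a + (u + v) / 2 \<le> 3 / 2 * P + 3 / 2 * Q"
        if "a \<le> P" "b \<le> Q" "u \<le> P" "v \<le> Q" for a b u v P Q :: real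
        using that by (simp add: field_simps)
      show ?thesis unfolding distrib_left mult.assoc
        by (rule arith[OF lin[of ?x] lin[of ?y] abs_diff_clip_le(2)[OF c \<delta>, of ?x]
          abs_diff_clip_le(2)[OF c \<delta>, of ?y]])
    qed
    finally show "\<bar>?x * ?y - ?x1 * ?y1\<bar> \<le> 3/2 * c powr (- \<delta>) * (?P X \<omega> + ?P Y \<omega>)" .
  qed (use int int1 iX iY in auto)
  also have "\<dots> = 3/2 * c powr (- \<delta>) * (expectation (?P X) + expectation (?P Y))"
    using iX iY by simp
  also have "\<dots> \<le> 3/2 * c powr (- \<delta>) * (K + K)"
    using KX KY by (intro mult_left_mono add_mono) auto
  finally have prods: "\<bar>expectation (\<lambda>\<omega>. X \<omega> * Y \<omega>) - expectation (\<lambda>\<omega>. ?X1 \<omega> * ?Y1 \<omega>)\<bar>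
    \<le> 3 * K * c powr (- \<delta>)" by (simp add: mult_ac)
  have cle: "c powr (- 1 - \<delta>) \<le> c powr (- \<delta>)" using c by (intro powr_mono) auto
  have mean: "\<bar>expectation U\<bar> \<le> 1 + K" "\<bar>expectation (\<lambda>\<omega>. clip c (U \<omega>))\<bar> \<le> 1 + K"
      "\<bar>expectation U - expectation (\<lambda>\<omega>. clip c (U \<omega>))\<bar> \<le> K * c powr (- \<delta>)"
    if [measurable]: "U \<in> borel_measurable M" and i: "integrable M U"
       "integrable M (\<lambda>\<omega>. clip c (U \<omega>))" "integrable M (?P U)"
       and KU: "expectation (?P U) \<le> K" for U
  proof -
    have "expectation (\<lambda>\<omega>. \<bar>U \<omega>\<bar>) \<le> expectation (\<lambda>\<omega>. 1 + ?P U \<omega>)"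
      using i abs_le_one_plus_powr[OF p(1)] by (intro integral_mono) auto
    then have *: "expectation (\<lambda>\<omega>. \<bar>U \<omega>\<bar>) \<le> 1 + K" using i KU by (simp add: prob_space)
    then show "\<bar>expectation U\<bar> \<le> 1 + K" using integral_abs_bound[of M U] by linarith
    have "expectation (\<lambda>\<omega>. \<bar>clip c (U \<omega>)\<bar>) \<le> expectation (\<lambda>\<omega>. \<bar>U \<omega>\<bar>)"
      using i abs_clip_le_abs[OF c0] by (intro integral_mono) auto
    then show "\<bar>expectation (\<lambda>\<omega>. clip c (U \<omega>))\<bar> \<le> 1 + K"
      using * integral_abs_bound[of M "\<lambda>\<omega>. clip c (U \<omega>)"] by linarith
    have "\<bar>expectation U - expectation (\<lambda>\<omega>. clip c (U \<omega>))\<bar> = \<bar>expectation (\<lambda>\<omega>. U \<omega> - clip c (U \<omega>))\<bar>"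
      using i by simp
    also have "\<dots> \<le> expectation (\<lambda>\<omega>. \<bar>U \<omega> - clip c (U \<omega>)\<bar>)" by (rule integral_abs_bound)
    also have "\<dots> \<le> expectation (\<lambda>\<omega>. c powr (- 1 - \<delta>) * ?P U \<omega>)"
      using i abs_diff_clip_le(1)[OF c \<delta>] by (intro integral_mono) auto
    also have "\<dots> = c powr (- 1 - \<delta>) * expectation (?P U)" by simp
    also have "\<dots> \<le> c powr (- \<delta>) * K" using KU cle K by (intro mult_mono) auto
    finally show "\<bar>expectation U - expectation (\<lambda>\<omega>. clip c (U \<omega>))\<bar> \<le> K * c powr (- \<delta>)"
      by (simp add: mult_ac)
  qed
  have "\<bar>x * y - x1 * y1\<bar> \<le> \<bar>x\<bar> * \<bar>y - y1\<bar> + \<bar>y1\<bar> * \<bar>x - x1\<bar>" for x y x1 y1 :: real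
    using abs_triangle_ineq[of "x * (y - y1)" "y1 * (x - x1)"] by (simp add: abs_mult[symmetric] algebra_simps)
  then have "\<bar>expectation X * expectation Y - expectation ?X1 * expectation ?Y1\<bar>
    \<le> \<bar>expectation X\<bar> * \<bar>expectation Y - expectation ?Y1\<bar>
      + \<bar>expectation ?Y1\<bar> * \<bar>expectation X - expectation ?X1\<bar>" .
  also have "\<dots> \<le> (1 + K) * (K * c powr (- \<delta>)) + (1 + K) * (K * c powr (- \<delta>))"
    using mean(1)[OF assms(1) int(1) int1(1) iX KX] mean(3)[OF assms(1) int(1) int1(1) iX KX]
      mean(2,3)[OF assms(2) int(2) int1(2) iY KY] K
    by (intro add_mono mult_mono) auto
  also have "\<dots> = (2 * K + 2 * K\<^sup>2) * c powr (- \<delta>)" by (simp add: algebra_simps power2_eq_square)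
  finally have "\<bar>expectation X * expectation Y - expectation ?X1 * expectation ?Y1\<bar>
    \<le> (2 * K + 2 * K\<^sup>2) * c powr (- \<delta>)" .
  moreover have "\<bar>e - m\<bar> \<le> A + B + C" if "\<bar>e - e1\<bar> \<le> A" "\<bar>m - m1\<bar> \<le> B" "\<bar>e1 - m1\<bar> \<le> C"
    for e m e1 m1 A B C :: real using that by linarith
  ultimately have "\<bar>expectation (\<lambda>\<omega>. X \<omega> * Y \<omega>) - expectation X * expectation Y\<bar>
    \<le> 3 * K * c powr (- \<delta>) + (2 * K + 2 * K\<^sup>2) * c powr (- \<delta>) + 4 * c\<^sup>2 * a"
    using prods bounded by blast
  also have "\<dots> = 4 * a * c\<^sup>2 + (5 * K + 2 * K\<^sup>2) * c powr (- \<delta>)"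
    by (simp add: algebra_simps)
  finally show ?thesis .
qed

text \<open>Davydov's covariance inequality: the truncation level that balances both error terms is
  \<open>c = a powr (- 1 / (2 + \<delta>))\<close>.\<close>

lemma (in prob_space) cov_bound_mixing:
  fixes X Y :: "'a \<Rightarrow> real"
  assumes XY: "X \<in> borel_measurable M" "Y \<in> borel_measurable M"
    and \<delta>: "\<delta> > 0"
    and iX: "integrable M (\<lambda>\<omega>. \<bar>X \<omega>\<bar> powr (2 + \<delta>))"
    and iY: "integrable M (\<lambda>\<omega>. \<bar>Y \<omega>\<bar> powr (2 + \<delta>))"
    and KX: "expectation (\<lambda>\<omega>. \<bar>X \<omega>\<bar> powr (2 + \<delta>)) \<le> K"
    and KY: "expectation (\<lambda>\<omega>. \<bar>Y \<omega>\<bar> powr (2 + \<delta>)) \<le> K"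
    and a01: "0 \<le> a" "a \<le> 1"
    and a: "\<And>A B. A \<in> sets borel \<Longrightarrow> B \<in> sets borel \<Longrightarrow>
             \<bar>prob {\<omega>\<in>space M. X \<omega> \<in> A} * prob {\<omega>\<in>space M. Y \<omega> \<in> B}
               - prob {\<omega>\<in>space M. X \<omega> \<in> A \<and> Y \<omega> \<in> B}\<bar> \<le> a"
  shows "\<bar>expectation (\<lambda>\<omega>. X \<omega> * Y \<omega>) - expectation X * expectation Y\<bar>
     \<le> (4 + 5 * K + 2 * K\<^sup>2) * a powr (\<delta> / (2 + \<delta>))"
proof -
  let ?cov = "\<bar>expectation (\<lambda>\<omega>. X \<omega> * Y \<omega>) - expectation X * expectation Y\<bar>"
  \<comment> \<open>The bound is proved for every \<open>t \<ge> a\<close> in \<open>(0, 1]\<close>,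
    not just for \<open>t = a\<close>: at \<open>a = 0\<close> the level \<open>c\<close> would be
    \<open>0 powr _\<close>, that is \<open>0\<close>, and not at least \<open>1\<close>. That case
    follows by letting \<open>t\<close> tend to \<open>0\<close>, the exponent on the right being
    positive.\<close>
  have pos: "?cov \<le> (4 + 5 * K + 2 * K\<^sup>2) * t powr (\<delta> / (2 + \<delta>))" if t: "0 < t" "t \<le> 1" "a \<le> t" for t
  proof -
    define c where "c = t powr (- 1 / (2 + \<delta>))"
    have c1: "c \<ge> 1" unfolding c_def using t \<delta> powr_mono'[of "- 1 / (2 + \<delta>)" 0 t] by simp
    have "t * c\<^sup>2 = t powr 1 * (t powr (- 1 / (2 + \<delta>))) powr 2"
      using t c1 unfolding c_def by simp
    also have "\<dots> = t powr (\<delta> / (2 + \<delta>))"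
      using \<delta> unfolding powr_powr powr_add[symmetric] by (intro arg_cong2[where f="(powr)"]) (auto simp: field_simps)
    finally have 1: "t * c\<^sup>2 = t powr (\<delta> / (2 + \<delta>))" .
    have 2: "c powr (- \<delta>) = t powr (\<delta> / (2 + \<delta>))" unfolding c_def powr_powr by simp
    have "?cov \<le> 4 * t * c\<^sup>2 + (5 * K + 2 * K\<^sup>2) * c powr (- \<delta>)"
      using a t(3) by (intro cov_bound_truncation[OF XY \<delta> c1 iX iY KX KY]) (auto intro: order_trans)
    also have "\<dots> = 4 * (t * c\<^sup>2) + (5 * K + 2 * K\<^sup>2) * c powr (- \<delta>)" by simp
    also have "\<dots> = (4 + 5 * K + 2 * K\<^sup>2) * t powr (\<delta> / (2 + \<delta>))"
      unfolding 1 2 by (simp add: algebra_simps)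
    finally show ?thesis .
  qed
  show ?thesis
  proof (cases "a = 0")
    case False
    then show ?thesis using pos[of a] a01 by auto
  next
    case True
    have "((\<lambda>t. (4 + 5 * K + 2 * K\<^sup>2) * t powr (\<delta> / (2 + \<delta>)))
        \<longlongrightarrow> (4 + 5 * K + 2 * K\<^sup>2) * 0 powr (\<delta> / (2 + \<delta>))) (at_right (0::real))"
      using \<delta> by (intro tendsto_intros tendsto_powr') (auto simp: eventually_at_right intro!: exI[of _ 1])
    moreover have "\<forall>\<^sub>F t in at_right 0. ?cov \<le> (4 + 5 * K + 2 * K\<^sup>2) * t powr (\<delta> / (2 + \<delta>))"
      using pos True by (auto simp: eventually_at_right[of _ "1::real"] intro!: exI[of _ 1])
    ultimately show ?thesis
      unfolding True by (intro tendsto_lowerbound) auto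
  qed
qed

section \<open>Second moments of weighted sums\<close>

lemma (in prob_space) abs_prob_diff_le_1: "\<bar>prob A * prob B - prob C\<bar> \<le> 1"
  using mult_le_one[OF prob_le_1 measure_nonneg prob_le_1, of A B]
    mult_nonneg_nonneg[OF measure_nonneg measure_nonneg, of M A M B] prob_le_1[of C] measure_nonneg[of M C]
  by linarith

context prob_space
begin

text \<open>A supremum of reals is known to dominate its set when that set is bounded above; the
  crude bound \<open>1\<close> on differences of probabilities provides this.\<close>

lemma alpha_coeff_upper:
  assumes "A \<in> \<A>" "B \<in> \<B>"
  shows "\<bar>prob A * prob B - prob (A \<inter> B)\<bar> \<le> alpha_coeff M \<A> \<B>"
  unfolding alpha_coeff_def
  by (rule cSup_upper) (use assms abs_prob_diff_le_1 in \<open>auto intro!: bdd_aboveI[of _ 1]\<close>)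

lemma alpha_coeff_le_1:
  assumes "\<A> \<noteq> {}" "\<B> \<noteq> {}"
  shows "alpha_coeff M \<A> \<B> \<le> 1"
  unfolding alpha_coeff_def
  by (rule cSup_least) (use assms abs_prob_diff_le_1 in auto)

lemma alpha_coeff_generated_le_1: "alpha_coeff M (generated_sigma M Y I) (generated_sigma M Y J) \<le> 1"
  by (rule alpha_coeff_le_1) (auto simp: generated_sigma_def intro: sigma_sets.Empty)

lemma alpha_coeff_le_alpha_mix:
  assumes "m \<ge> 1"
  shows "alpha_coeff M (generated_sigma M Y {1..m}) (generated_sigma M Y {k + m..}) \<le> alpha_mix M Y k"
  unfolding alpha_mix_def
  by (rule cSUP_upper) (use assms alpha_coeff_generated_le_1 in \<open>auto intro!: bdd_aboveI[of _ 1]\<close>)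

lemma alpha_mix_le_1: "alpha_mix M Y k \<le> 1"
  unfolding alpha_mix_def by (rule cSUP_least) (auto intro: alpha_coeff_generated_le_1)

lemma vimage_in_generated_sigma:
  "j \<in> I \<Longrightarrow> B \<in> sets borel \<Longrightarrow> Y j -` B \<inter> space M \<in> generated_sigma M Y I"
  unfolding generated_sigma_def by (auto intro!: sigma_sets.Basic)

text \<open>Take \<open>m = i\<close> in the supremum: the past \<open>{1..i}\<close> contains the
  index \<open>i\<close> and the future \<open>{k + i..}\<close> contains \<open>i + k\<close>, so
  two variables at lag \<open>k\<close> are controlled by the coefficient at exactly that
  lag.\<close>

lemma abs_prob_diff_le_alpha_mix:
  assumes "i \<ge> 1" "A \<in> sets borel" "B \<in> sets borel"
  shows "\<bar>prob {\<omega>\<in>space M. Y i \<omega> \<in> A} * prob {\<omega>\<in>space M. Y (i + k) \<omega> \<in> B}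
      - prob {\<omega>\<in>space M. Y i \<omega> \<in> A \<and> Y (i + k) \<omega> \<in> B}\<bar> \<le> alpha_mix M Y k"
proof -
  have "Y i -` A \<inter> space M \<in> generated_sigma M Y {1..i}"
       "Y (i + k) -` B \<inter> space M \<in> generated_sigma M Y {k + i..}"
    using assms by (auto intro!: vimage_in_generated_sigma)
  then have "\<bar>prob (Y i -` A \<inter> space M) * prob (Y (i + k) -` B \<inter> space M)
      - prob ((Y i -` A \<inter> space M) \<inter> (Y (i + k) -` B \<inter> space M))\<bar>
     \<le> alpha_coeff M (generated_sigma M Y {1..i}) (generated_sigma M Y {k + i..})"
    by (rule alpha_coeff_upper)
  also have "\<dots> \<le> alpha_mix M Y k" by (rule alpha_coeff_le_alpha_mix) fact
  finally show ?thesis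
    by (simp add: vimage_def Int_def conj_ac cong: conj_cong)
qed

lemma alpha_mix_nonneg: "alpha_mix M Y k \<ge> 0"
  using abs_prob_diff_le_alpha_mix[of 1 "{}" "{}" Y k] by simp

end

lemma (in prob_space) strictly_stationary_distr:
  assumes st: "strictly_stationary M Y" and Y: "\<And>i. i \<ge> 1 \<Longrightarrow> Y i \<in> borel_measurable M" and "i \<ge> 1"
  shows "distr M borel (Y i) = distr M borel (Y 1)"
proof -
  have "distr M (Pi\<^sub>M {1} (\<lambda>_. borel)) (\<lambda>\<omega>. \<lambda>j\<in>{1}. Y (j + (i - 1)) \<omega>)
      = distr M (Pi\<^sub>M {1} (\<lambda>_. borel)) (\<lambda>\<omega>. \<lambda>j\<in>{1}. Y j \<omega>)"
    using st unfolding strictly_stationary_def by (auto elim!: allE[of _ "{1}"])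
  then have eq: "distr (distr M (Pi\<^sub>M {1} (\<lambda>_. borel)) (\<lambda>\<omega>. \<lambda>j\<in>{1}. Y (j + (i - 1)) \<omega>)) borel (\<lambda>x. x 1)
      = distr (distr M (Pi\<^sub>M {1} (\<lambda>_. borel)) (\<lambda>\<omega>. \<lambda>j\<in>{1}. Y j \<omega>)) borel (\<lambda>x. x 1)" by simp
  have proj: "distr (distr M (Pi\<^sub>M {1} (\<lambda>_. borel)) (\<lambda>\<omega>. \<lambda>j\<in>{1}. Z j \<omega>)) borel (\<lambda>x. x 1)
      = distr M borel (Z 1)"
    if "Z 1 \<in> borel_measurable M" for Z :: "nat \<Rightarrow> 'a \<Rightarrow> real"
    by (subst distr_distr) (use that in \<open>auto simp: comp_def intro!: measurable_restrict\<close>)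
  show ?thesis using eq proj[of "\<lambda>j. Y (j + (i - 1))"] proj[of Y] Y[of 1] Y[of i] \<open>i \<ge> 1\<close> by simp
qed

lemma (in prob_space) stationary_expectation:
  fixes f :: "real \<Rightarrow> real"
  assumes st: "strictly_stationary M Y" and Y: "\<And>i. i \<ge> 1 \<Longrightarrow> Y i \<in> borel_measurable M" and i: "i \<ge> 1"
    and [measurable]: "f \<in> borel_measurable borel"
  shows "integrable M (\<lambda>\<omega>. f (Y i \<omega>)) \<longleftrightarrow> integrable M (\<lambda>\<omega>. f (Y 1 \<omega>))"
    and "expectation (\<lambda>\<omega>. f (Y i \<omega>)) = expectation (\<lambda>\<omega>. f (Y 1 \<omega>))"
  using strictly_stationary_distr[OF st Y i] Y[OF i] Y[OF order_refl]
    integrable_distr_eq[of "Y i" M borel f] integrable_distr_eq[of "Y 1" M borel f]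
    integral_distr[of "Y i" M borel f] integral_distr[of "Y 1" M borel f] by simp_all

text \<open>To the left and to the right of \<open>i\<close> every lag occurs at most once, so each
  half is a sum of distinct terms of the series; lag \<open>0\<close> is counted on the left. The
  case distinction spells out \<open>\<bar>i - k\<bar>\<close>, since subtraction on
  \<open>nat\<close> truncates.\<close>

lemma sum_dist_le_suminf:
  fixes \<gamma> :: "nat \<Rightarrow> real"
  assumes "summable \<gamma>" "\<And>k. \<gamma> k \<ge> 0" "finite I"
  shows "(\<Sum>k\<in>I. \<gamma> (if k \<le> i then i - k else k - i)) \<le> 2 * suminf \<gamma>"
proof -
  have 1: "(\<Sum>k\<in>I \<inter> {..i}. \<gamma> (i - k)) \<le> suminf \<gamma>"
    using assms by (subst sum.reindex[symmetric, of "\<lambda>k. i - k", unfolded comp_def])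
       (auto simp: inj_on_def intro!: sum_le_suminf)
  have 2: "(\<Sum>k\<in>I - {..i}. \<gamma> (k - i)) \<le> suminf \<gamma>"
    using assms by (subst sum.reindex[symmetric, of "\<lambda>k. k - i", unfolded comp_def])
       (auto simp: inj_on_def intro!: sum_le_suminf)
  have "(\<Sum>k\<in>I. \<gamma> (if k \<le> i then i - k else k - i))
    = (\<Sum>k\<in>I \<inter> {..i}. \<gamma> (i - k)) + (\<Sum>k\<in>I - {..i}. \<gamma> (k - i))"
    using assms(3) by (subst sum.Int_Diff[of I _ "{..i}"]) (auto intro!: arg_cong2[where f="(+)"] sum.cong)
  then show ?thesis using 1 2 by linarith
qed

text \<open>Expanding the square leaves a double sum of mixed moments. Each row is bounded by the
  summable series over the lags, so the growth is linear in \<open>card I\<close> instead of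
  quadratic. Weights are present because \<sigma> varies within a block.\<close>

lemma (in prob_space) weighted_sum_second_moment:
  fixes Z :: "nat \<Rightarrow> 'a \<Rightarrow> real" and w :: "nat \<Rightarrow> real"
  assumes Z: "\<And>i. i \<in> I \<Longrightarrow> Z i \<in> borel_measurable M"
    and sq: "\<And>i. i \<in> I \<Longrightarrow> integrable M (\<lambda>\<omega>. (Z i \<omega>)\<^sup>2)"
    and \<gamma>: "summable \<gamma>" "\<And>k. \<gamma> k \<ge> 0"
    and cov: "\<And>i k. i \<in> I \<Longrightarrow> i + k \<in> I \<Longrightarrow> \<bar>expectation (\<lambda>\<omega>. Z i \<omega> * Z (i + k) \<omega>)\<bar> \<le> \<gamma> k"
    and w: "\<And>i. i \<in> I \<Longrightarrow> \<bar>w i\<bar> \<le> A" and A: "A \<ge> 0" and I: "finite I"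
  shows "integrable M (\<lambda>\<omega>. (\<Sum>i\<in>I. w i * Z i \<omega>)\<^sup>2)"
    and "expectation (\<lambda>\<omega>. (\<Sum>i\<in>I. w i * Z i \<omega>)\<^sup>2) \<le> 2 * suminf \<gamma> * A\<^sup>2 * card I"
proof -
  have iZ: "integrable M (\<lambda>\<omega>. Z i \<omega> * Z k \<omega>)" if "i \<in> I" "k \<in> I" for i k
    using integrable_mult_of_squares Z sq that by blast
  have eq: "(\<Sum>i\<in>I. w i * Z i \<omega>)\<^sup>2 = (\<Sum>i\<in>I. \<Sum>k\<in>I. w i * w k * (Z i \<omega> * Z k \<omega>))" for \<omega>
    by (simp add: power2_eq_square sum_product mult_ac)
  show "integrable M (\<lambda>\<omega>. (\<Sum>i\<in>I. w i * Z i \<omega>)\<^sup>2)"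
    unfolding eq using iZ by auto
  have cov': "\<bar>expectation (\<lambda>\<omega>. Z i \<omega> * Z k \<omega>)\<bar> \<le> \<gamma> (if k \<le> i then i - k else k - i)"
    if "i \<in> I" "k \<in> I" for i k
    using cov[of i "k - i"] cov[of k "i - k"] that by (auto simp: mult.commute)
  have "expectation (\<lambda>\<omega>. (\<Sum>i\<in>I. w i * Z i \<omega>)\<^sup>2)
      = (\<Sum>i\<in>I. \<Sum>k\<in>I. w i * w k * expectation (\<lambda>\<omega>. Z i \<omega> * Z k \<omega>))"
    unfolding eq using iZ by (simp add: Bochner_Integration.integral_sum)
  also have "\<dots> \<le> (\<Sum>i\<in>I. \<Sum>k\<in>I. A\<^sup>2 * \<gamma> (if k \<le> i then i - k else k - i))"
  proof (intro sum_mono)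
    fix i k assume ik: "i \<in> I" "k \<in> I"
    have "w i * w k * expectation (\<lambda>\<omega>. Z i \<omega> * Z k \<omega>) \<le> \<bar>w i\<bar> * \<bar>w k\<bar> * \<bar>expectation (\<lambda>\<omega>. Z i \<omega> * Z k \<omega>)\<bar>"
      unfolding abs_mult[symmetric] by linarith
    also have "\<dots> \<le> A * A * \<gamma> (if k \<le> i then i - k else k - i)"
      using w[OF ik(1)] w[OF ik(2)] A cov'[OF ik] by (intro mult_mono) auto
    finally show "w i * w k * expectation (\<lambda>\<omega>. Z i \<omega> * Z k \<omega>) \<le> A\<^sup>2 * \<gamma> (if k \<le> i then i - k else k - i)"
      by (simp add: power2_eq_square)
  qed
  also have "\<dots> = (\<Sum>i\<in>I. A\<^sup>2 * (\<Sum>k\<in>I. \<gamma> (if k \<le> i then i - k else k - i)))"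
    by (simp only: sum_distrib_left)
  also have "\<dots> \<le> (\<Sum>i\<in>I. A\<^sup>2 * (2 * suminf \<gamma>))"
    by (intro sum_mono mult_left_mono sum_dist_le_suminf \<gamma> I) auto
  finally show "expectation (\<lambda>\<omega>. (\<Sum>i\<in>I. w i * Z i \<omega>)\<^sup>2) \<le> 2 * suminf \<gamma> * A\<^sup>2 * card I"
    by (simp add: mult_ac)
qed

text \<open>Two instances of \<open>f\<close> are wanted: the identity for the block mean and
  \<open>y\<^sup>2 - 1\<close> for the block variance. The constant does not depend on the index set
  or the weights, so it serves all blocks at once. Centring turns covariances into means of
  products, and preimages under \<open>f\<close> reduce events of \<open>f (Y i)\<close> to events
  of \<open>Y i\<close>.\<close>

lemma (in prob_space) mixing_sum_second_moment:
  fixes Y :: "nat \<Rightarrow> 'a \<Rightarrow> real" and f :: "real \<Rightarrow> real"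
  assumes Y: "\<And>i. i \<ge> 1 \<Longrightarrow> Y i \<in> borel_measurable M"
    and st: "strictly_stationary M Y"
    and f [measurable]: "f \<in> borel_measurable borel"
    and \<delta>: "\<delta> > 0"
    and sm: "summable (\<lambda>k. alpha_mix M Y (Suc k) powr (\<delta> / (2 + \<delta>)))"
    and i: "integrable M (\<lambda>\<omega>. \<bar>f (Y 1 \<omega>)\<bar> powr (2 + \<delta>))"
    and m: "expectation (\<lambda>\<omega>. f (Y 1 \<omega>)) = 0"
  obtains C where "C \<ge> 0"
    "\<And>I w A. finite I \<Longrightarrow> I \<subseteq> {1..} \<Longrightarrow> (\<And>i. i \<in> I \<Longrightarrow> \<bar>w i\<bar> \<le> A) \<Longrightarrow> A \<ge> 0 \<Longrightarrow>
        integrable M (\<lambda>\<omega>. (\<Sum>i\<in>I. w i * f (Y i \<omega>))\<^sup>2)"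
    "\<And>I w A. finite I \<Longrightarrow> I \<subseteq> {1..} \<Longrightarrow> (\<And>i. i \<in> I \<Longrightarrow> \<bar>w i\<bar> \<le> A) \<Longrightarrow> A \<ge> 0 \<Longrightarrow>
        expectation (\<lambda>\<omega>. (\<Sum>i\<in>I. w i * f (Y i \<omega>))\<^sup>2) \<le> C * A\<^sup>2 * card I"
proof -
  let ?K = "expectation (\<lambda>\<omega>. \<bar>f (Y 1 \<omega>)\<bar> powr (2 + \<delta>))"
  let ?D = "4 + 5 * ?K + 2 * ?K\<^sup>2"
  \<comment> \<open>Lag \<open>0\<close> is set to the second moment, since summability is assumed
    from lag \<open>1\<close> on; for positive lags the value is the right-hand side of the
    covariance inequality.\<close>
  define \<gamma> where "\<gamma> k = (if k = 0 then expectation (\<lambda>\<omega>. (f (Y 1 \<omega>))\<^sup>2)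
     else ?D * alpha_mix M Y k powr (\<delta> / (2 + \<delta>)))" for k
  have fY: "(\<lambda>\<omega>. f (Y i \<omega>)) \<in> borel_measurable M" if "i \<ge> 1" for i
    using Y[OF that] by measurable
  have mom: "integrable M (\<lambda>\<omega>. \<bar>f (Y i \<omega>)\<bar> powr (2 + \<delta>))"
      "expectation (\<lambda>\<omega>. \<bar>f (Y i \<omega>)\<bar> powr (2 + \<delta>)) = ?K"
      "expectation (\<lambda>\<omega>. (f (Y i \<omega>))\<^sup>2) = expectation (\<lambda>\<omega>. (f (Y 1 \<omega>))\<^sup>2)"
      "expectation (\<lambda>\<omega>. f (Y i \<omega>)) = 0"
    if "i' = i" "i \<ge> 1" for i i' :: nat
    using stationary_expectation[OF st Y that(2), of "\<lambda>x. \<bar>f x\<bar> powr (2 + \<delta>)"]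
      stationary_expectation[OF st Y that(2), of "\<lambda>x. (f x)\<^sup>2"]
      stationary_expectation[OF st Y that(2), of f] m \<open>integrable M (\<lambda>\<omega>. \<bar>f (Y 1 \<omega>)\<bar> powr (2 + \<delta>))\<close> by simp_all
  note mom = mom[OF refl]
  have K: "?K \<ge> 0" by (rule integral_nonneg_AE) auto
  have \<gamma>0: "\<gamma> k \<ge> 0" for k
    using K by (auto simp: \<gamma>_def)
  have "summable (\<lambda>k. \<gamma> (Suc k))" using sm by (auto simp: \<gamma>_def)
  then have \<gamma>s: "summable \<gamma>" by (simp only: summable_Suc_iff)
  have sq: "integrable M (\<lambda>\<omega>. (f (Y i \<omega>))\<^sup>2)" if "i \<ge> 1" for i
    using integrable_of_powr(2)[OF fY[OF that] mom(1)[OF that]] \<delta> by simp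
  have cov: "\<bar>expectation (\<lambda>\<omega>. f (Y i \<omega>) * f (Y (i + k) \<omega>))\<bar> \<le> \<gamma> k" if i: "i \<ge> 1" for i k
  proof (cases "k = 0")
    case True
    have "expectation (\<lambda>\<omega>. (f (Y 1 \<omega>))\<^sup>2) \<ge> 0" by (rule integral_nonneg_AE) auto
    then show ?thesis using mom(3)[OF i] True by (simp add: \<gamma>_def power2_eq_square)
  next
    case False
    have ik: "i + k \<ge> 1" using i by simp
    have "\<bar>expectation (\<lambda>\<omega>. f (Y i \<omega>) * f (Y (i + k) \<omega>))
       - expectation (\<lambda>\<omega>. f (Y i \<omega>)) * expectation (\<lambda>\<omega>. f (Y (i + k) \<omega>))\<bar>
      \<le> ?D * alpha_mix M Y k powr (\<delta> / (2 + \<delta>))"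
    proof (rule cov_bound_mixing[OF fY[OF i] fY[OF ik] \<delta> mom(1)[OF i] mom(1)[OF ik]])
      fix A B :: "real set" assume AB: "A \<in> sets borel" "B \<in> sets borel"
      have "f -` A \<in> sets borel" "f -` B \<in> sets borel"
        using measurable_sets[OF f AB(1)] measurable_sets[OF f AB(2)] by auto
      from abs_prob_diff_le_alpha_mix[OF i this, of Y k]
      show "\<bar>prob {\<omega>\<in>space M. f (Y i \<omega>) \<in> A} * prob {\<omega>\<in>space M. f (Y (i + k) \<omega>) \<in> B}
        - prob {\<omega>\<in>space M. f (Y i \<omega>) \<in> A \<and> f (Y (i + k) \<omega>) \<in> B}\<bar> \<le> alpha_mix M Y k" by simp
    qed (use mom(2)[OF i] mom(2)[OF ik] alpha_mix_nonneg alpha_mix_le_1 in auto)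
    then show ?thesis using False mom(4)[OF i] by (simp add: \<gamma>_def)
  qed
  show ?thesis
  proof (rule that[of "2 * suminf \<gamma>"])
    show "2 * suminf \<gamma> \<ge> 0" using suminf_nonneg[OF \<gamma>s] \<gamma>0 by simp
    fix I and w :: "nat \<Rightarrow> real" and A
    assume I: "finite I" "I \<subseteq> {1..}" and w: "\<And>i. i \<in> I \<Longrightarrow> \<bar>w i\<bar> \<le> A" and A: "A \<ge> 0"
    have ge: "i \<ge> 1" if "i \<in> I" for i using I that by auto
    note * = weighted_sum_second_moment[of I "\<lambda>i \<omega>. f (Y i \<omega>)", OF fY[OF ge] sq[OF ge] \<gamma>s \<gamma>0 cov[OF ge] w A I(1)]
    show "integrable M (\<lambda>\<omega>. (\<Sum>i\<in>I. w i * f (Y i \<omega>))\<^sup>2)" by (rule *(1))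
    show "expectation (\<lambda>\<omega>. (\<Sum>i\<in>I. w i * f (Y i \<omega>))\<^sup>2) \<le> 2 * suminf \<gamma> * A\<^sup>2 * card I" by (rule *(2))
  qed
qed

section \<open>Local variances\<close>

lemma card_block: "j \<ge> 1 \<Longrightarrow> card {(j - 1) * l + 1..j * l} = l" for j l :: nat
  by (cases j) auto

text \<open>The shift formula for empirical variances: the second moment about an arbitrary point
  \<open>m\<close> minus the squared distance of \<open>m\<close> from the mean. With the constant
  value of \<mu> as \<open>m\<close>, that value drops out of the statistic.\<close>

lemma local_var_eq:
  assumes l: "l \<ge> 1" and j: "j \<ge> 1"
  shows "local_var l x j = 1 / l * (\<Sum>i\<in>{(j - 1) * l + 1..j * l}. (x i - m)\<^sup>2)
     - (1 / l * (\<Sum>i\<in>{(j - 1) * l + 1..j * l}. x i - m))\<^sup>2"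
proof -
  define I where "I = {(j - 1) * l + 1..j * l}"
  have card: "real (card I) = l" unfolding I_def card_block[OF j] by simp
  define c where "c = 1 / l * (\<Sum>i\<in>I. x i - m)"
  have c: "(\<Sum>i\<in>I. x i - m) = l * c" using l by (simp add: c_def)
  have cx: "sum x I = l * c + l * m" using c by (simp add: sum_subtractf card)
  have mean: "local_mean l x j = m + c"
    using l unfolding local_mean_def I_def[symmetric] c_def sum_subtractf by (simp add: card field_simps)
  have "(\<Sum>i\<in>I. (x i - local_mean l x j)\<^sup>2) = (\<Sum>i\<in>I. (x i - m)\<^sup>2 - 2 * c * (x i - m) + c\<^sup>2)"
    unfolding mean by (intro sum.cong) (auto simp: power2_eq_square algebra_simps)
  also have "\<dots> = (\<Sum>i\<in>I. (x i - m)\<^sup>2) - 2 * c * (l * c) + l * c\<^sup>2"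
    unfolding sum.distrib sum_subtractf[of "\<lambda>i. (x i - m)\<^sup>2"] sum_distrib_left[symmetric] c by (simp add: card)
  also have "\<dots> = (\<Sum>i\<in>I. (x i - m)\<^sup>2) - l * c\<^sup>2" by (simp add: power2_eq_square)
  finally have "local_var l x j = 1 / l * ((\<Sum>i\<in>I. (x i - m)\<^sup>2) - l * c\<^sup>2)"
    unfolding local_var_def I_def[symmetric] by simp
  also have "\<dots> = 1 / l * (\<Sum>i\<in>I. (x i - m)\<^sup>2) - c\<^sup>2" using l by (simp add: right_diff_distrib)
  finally show ?thesis unfolding c_def I_def .
qed

lemma local_var_nonneg: "local_var l x j \<ge> 0"
  unfolding local_var_def by (simp add: sum_nonneg)

text \<open>About the reference point \<open>m\<close> only \<open>d i + w i * y i\<close> remains.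
  Writing \<open>(y i)\<^sup>2\<close> as \<open>1 + ((y i)\<^sup>2 - 1)\<close> separates the
  deterministic target from a sum that is centred when \<open>y\<close> has unit second moment;
  \<open>d\<close> stands for deviations of the mean from \<open>m\<close>.\<close>

lemma local_var_expand:
  fixes d w y :: "nat \<Rightarrow> real"
  assumes l: "l \<ge> 1" and j: "j \<ge> 1"
  defines "I \<equiv> {(j - 1) * l + 1..j * l}"
  shows "local_var l (\<lambda>i. m + d i + w i * y i) j - 1 / l * (\<Sum>i\<in>I. (w i)\<^sup>2)
    = 1 / l * (\<Sum>i\<in>I. (w i)\<^sup>2 * ((y i)\<^sup>2 - 1)) + 1 / l * (\<Sum>i\<in>I. 2 * w i * d i * y i + (d i)\<^sup>2)
      - (1 / l * (\<Sum>i\<in>I. w i * y i) + 1 / l * (\<Sum>i\<in>I. d i))\<^sup>2"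
proof -
  have "(\<Sum>i\<in>I. (m + d i + w i * y i - m)\<^sup>2)
      = (\<Sum>i\<in>I. (w i)\<^sup>2 + (w i)\<^sup>2 * ((y i)\<^sup>2 - 1) + (2 * w i * d i * y i + (d i)\<^sup>2))"
    by (intro sum.cong refl) (simp add: power2_eq_square algebra_simps)
  also have "\<dots> = (\<Sum>i\<in>I. (w i)\<^sup>2) + (\<Sum>i\<in>I. (w i)\<^sup>2 * ((y i)\<^sup>2 - 1))
      + (\<Sum>i\<in>I. 2 * w i * d i * y i + (d i)\<^sup>2)" by (simp only: sum.distrib)
  finally have 1: "(\<Sum>i\<in>I. (m + d i + w i * y i - m)\<^sup>2) = \<dots>" .
  have 2: "(\<Sum>i\<in>I. m + d i + w i * y i - m) = (\<Sum>i\<in>I. w i * y i) + (\<Sum>i\<in>I. d i)"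
    by (simp add: sum.distrib)
  show ?thesis
    unfolding local_var_eq[OF l j, of _ m] I_def[symmetric] 1 2 by (simp add: distrib_left)
qed

text \<open>Random quantities enter the bound only through two squared sums and a weighted sum of
  \<open>\<bar>y i\<bar>\<close>, so expectations can be taken term by term. The perturbation is
  measured by its total mass \<open>D\<close>, so that a single shifted observation costs
  \<open>O(1 / l)\<close> in mean.\<close>

lemma local_var_error_le:
  fixes d w y :: "nat \<Rightarrow> real"
  assumes l: "l \<ge> 1" and j: "j \<ge> 1"
  defines "I \<equiv> {(j - 1) * l + 1..j * l}"
  assumes w: "\<And>i. i \<in> I \<Longrightarrow> \<bar>w i\<bar> \<le> A" and d: "(\<Sum>i\<in>I. \<bar>d i\<bar>) \<le> D"
  shows "\<bar>local_var l (\<lambda>i. m + d i + w i * y i) j - 1 / l * (\<Sum>i\<in>I. (w i)\<^sup>2)\<bar>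
    \<le> ((\<Sum>i\<in>I. (w i)\<^sup>2 * ((y i)\<^sup>2 - 1))\<^sup>2 / sqrt l + sqrt l) / (2 * real l)
      + 2 * A * (\<Sum>i\<in>I. \<bar>d i\<bar> * \<bar>y i\<bar>) / l + 3 * D\<^sup>2 / l + 2 * (\<Sum>i\<in>I. w i * y i)\<^sup>2 / (real l)\<^sup>2"
proof -
  define S2 where "S2 = (\<Sum>i\<in>I. (w i)\<^sup>2 * ((y i)\<^sup>2 - 1))"
  define S1 where "S1 = (\<Sum>i\<in>I. w i * y i)"
  define T where "T = (\<Sum>i\<in>I. \<bar>d i\<bar> * \<bar>y i\<bar>)"
  define R where "R = (\<Sum>i\<in>I. 2 * w i * d i * y i + (d i)\<^sup>2)"
  define d0 where "d0 = (\<Sum>i\<in>I. d i)"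
  have lpos: "real l \<ge> 1" "sqrt l > 0" using l by auto
  have D: "D \<ge> 0" using d by (meson order_trans sum_nonneg abs_ge_zero)
  have [simp]: "finite I" by (simp add: I_def)
  have di: "\<bar>d i\<bar> \<le> D" if "i \<in> I" for i
    using d member_le_sum[of i I "\<lambda>i. \<bar>d i\<bar>"] that by auto
  have R: "\<bar>R\<bar> \<le> 2 * A * T + D\<^sup>2"
  proof -
    have "\<bar>R\<bar> \<le> (\<Sum>i\<in>I. \<bar>2 * w i * d i * y i + (d i)\<^sup>2\<bar>)" unfolding R_def by (rule sum_abs)
    also have "\<dots> \<le> (\<Sum>i\<in>I. 2 * A * (\<bar>d i\<bar> * \<bar>y i\<bar>) + D * \<bar>d i\<bar>)"
    proof (rule sum_mono)
      fix i assume i: "i \<in> I"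
      have "\<bar>2 * w i * d i * y i + (d i)\<^sup>2\<bar> \<le> \<bar>2 * w i * d i * y i\<bar> + \<bar>(d i)\<^sup>2\<bar>" by (rule abs_triangle_ineq)
      also have "\<dots> = 2 * \<bar>w i\<bar> * (\<bar>d i\<bar> * \<bar>y i\<bar>) + \<bar>d i\<bar> * \<bar>d i\<bar>"
        by (simp add: abs_mult power2_eq_square)
      also have "\<dots> \<le> 2 * A * (\<bar>d i\<bar> * \<bar>y i\<bar>) + D * \<bar>d i\<bar>"
        using w[OF i] di[OF i] by (intro add_mono mult_right_mono) auto
      finally show "\<bar>2 * w i * d i * y i + (d i)\<^sup>2\<bar> \<le> \<dots>" .
    qed
    also have "\<dots> = 2 * A * T + D * (\<Sum>i\<in>I. \<bar>d i\<bar>)"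
      by (simp add: sum.distrib sum_distrib_left T_def)
    also have "\<dots> \<le> 2 * A * T + D * D" using d D by (intro add_left_mono mult_left_mono) auto
    finally show ?thesis by (simp add: power2_eq_square)
  qed
  \<comment> \<open>The inequality between arithmetic and geometric mean with weight
    \<open>sqrt l\<close>, the typical size of \<open>S2\<close>: once the mean of
    \<open>S2\<^sup>2\<close> is \<open>O(l)\<close>, both halves are \<open>O(sqrt l)\<close>. It
    takes the place of the Cauchy-Schwarz inequality.\<close>
  have am: "\<bar>S2\<bar> \<le> (S2\<^sup>2 / sqrt l + sqrt l) / 2"
  proof -
    have "0 \<le> (\<bar>S2\<bar> - sqrt l)\<^sup>2" by simp
    then have "2 * \<bar>S2\<bar> * sqrt l \<le> S2\<^sup>2 + (sqrt l)\<^sup>2" by (simp add: power2_diff)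
    then have "2 * \<bar>S2\<bar> \<le> (S2\<^sup>2 + (sqrt l)\<^sup>2) / sqrt l" using lpos by (simp add: pos_le_divide_eq)
    also have "\<dots> = S2\<^sup>2 / sqrt l + sqrt l" using lpos by (simp add: add_divide_distrib real_div_sqrt)
    finally show ?thesis by simp
  qed
  have sq: "(S1 / l + d0 / l)\<^sup>2 \<le> 2 * S1\<^sup>2 / (real l)\<^sup>2 + 2 * D\<^sup>2 / l"
  proof -
    have d0: "\<bar>d0\<bar> \<le> D" unfolding d0_def using d by (rule order_trans[OF sum_abs])
    then have d02: "d0\<^sup>2 \<le> D\<^sup>2" by (metis abs_le_square_iff abs_of_nonneg D)
    have "(S1 / l + d0 / l)\<^sup>2 \<le> 2 * (S1 / l)\<^sup>2 + 2 * (d0 / l)\<^sup>2"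
    proof -
      have "(p + q)\<^sup>2 \<le> 2 * p\<^sup>2 + 2 * q\<^sup>2" for p q :: real
        using zero_le_power2[of "p - q"] by (simp add: power2_sum power2_diff)
      then show ?thesis .
    qed
    also have "\<dots> = 2 * S1\<^sup>2 / (real l)\<^sup>2 + 2 * d0\<^sup>2 / (real l * real l)" by (simp add: power2_eq_square)
    also have "\<dots> \<le> 2 * S1\<^sup>2 / (real l)\<^sup>2 + 2 * D\<^sup>2 / (real l * 1)"
      using lpos d02 by (intro add_left_mono frac_le mult_left_mono) auto
    finally show ?thesis by simp
  qed
  have "local_var l (\<lambda>i. m + d i + w i * y i) j - 1 / l * (\<Sum>i\<in>I. (w i)\<^sup>2)
     = S2 / l + R / l - (S1 / l + d0 / l)\<^sup>2"
    using local_var_expand[OF l j, of m d w y] by (simp add: S2_def S1_def R_def d0_def I_def)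
  then have "\<bar>local_var l (\<lambda>i. m + d i + w i * y i) j - 1 / l * (\<Sum>i\<in>I. (w i)\<^sup>2)\<bar>
     \<le> \<bar>S2\<bar> / l + \<bar>R\<bar> / l + (S1 / l + d0 / l)\<^sup>2"
    using abs_triangle_ineq4[of "S2 / l + R / l" "(S1 / l + d0 / l)\<^sup>2"] abs_triangle_ineq[of "S2 / l" "R / l"]
    by simp
  also have "\<dots> \<le> (S2\<^sup>2 / sqrt l + sqrt l) / 2 / l + (2 * A * T + D\<^sup>2) / l + (2 * S1\<^sup>2 / (real l)\<^sup>2 + 2 * D\<^sup>2 / l)"
    using am R sq by (intro add_mono divide_right_mono) auto
  also have "\<dots> = (S2\<^sup>2 / sqrt l + sqrt l) / (2 * real l) + 2 * A * T / l + 3 * D\<^sup>2 / l + 2 * S1\<^sup>2 / (real l)\<^sup>2"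
    by (simp add: add_divide_distrib)
  finally show ?thesis unfolding S2_def T_def S1_def .
qed


text \<open>Only the term in \<open>?S2\<close> is of order \<open>1 / sqrt l\<close>; the others
  are \<open>O(1 / l)\<close> and are weakened by \<open>sqrt l \<le> l\<close> to obtain one
  constant. Moment bounds appear as hypotheses, which keeps this step free of mixing.\<close>

lemma (in prob_space) local_var_error_expectation:
  fixes Y :: "nat \<Rightarrow> 'a \<Rightarrow> real" and d w :: "nat \<Rightarrow> real"
  assumes l: "l \<ge> 1" and j: "j \<ge> 1"
  defines "I \<equiv> {(j - 1) * l + 1..j * l}"
  assumes w: "\<And>i. i \<in> I \<Longrightarrow> \<bar>w i\<bar> \<le> A" and d: "(\<Sum>i\<in>I. \<bar>d i\<bar>) \<le> D" and A: "A \<ge> 0"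
    and Y: "\<And>i. i \<in> I \<Longrightarrow> Y i \<in> borel_measurable M"
    and i1: "\<And>i. i \<in> I \<Longrightarrow> integrable M (Y i)"
    and m1: "\<And>i. i \<in> I \<Longrightarrow> expectation (\<lambda>\<omega>. \<bar>Y i \<omega>\<bar>) \<le> m1"
    and i2: "\<And>i. i \<in> I \<Longrightarrow> integrable M (\<lambda>\<omega>. (Y i \<omega>)\<^sup>2)"
    and iS1: "integrable M (\<lambda>\<omega>. (\<Sum>i\<in>I. w i * Y i \<omega>)\<^sup>2)"
    and S1: "expectation (\<lambda>\<omega>. (\<Sum>i\<in>I. w i * Y i \<omega>)\<^sup>2) \<le> C1 * A\<^sup>2 * l"
    and iS2: "integrable M (\<lambda>\<omega>. (\<Sum>i\<in>I. (w i)\<^sup>2 * ((Y i \<omega>)\<^sup>2 - 1))\<^sup>2)"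
    and S2: "expectation (\<lambda>\<omega>. (\<Sum>i\<in>I. (w i)\<^sup>2 * ((Y i \<omega>)\<^sup>2 - 1))\<^sup>2) \<le> C2 * (A\<^sup>2)\<^sup>2 * l"
    and nonneg: "m1 \<ge> 0" "C1 \<ge> 0"
  shows "integrable M (\<lambda>\<omega>. local_var l (\<lambda>i. m + d i + w i * Y i \<omega>) j)"
    and "expectation (\<lambda>\<omega>. \<bar>local_var l (\<lambda>i. m + d i + w i * Y i \<omega>) j - 1 / l * (\<Sum>i\<in>I. (w i)\<^sup>2)\<bar>)
      \<le> ((C2 * (A\<^sup>2)\<^sup>2 + 1) / 2 + 2 * A * D * m1 + 3 * D\<^sup>2 + 2 * C1 * A\<^sup>2) / sqrt l"
proof -
  let ?S1 = "\<lambda>\<omega>. \<Sum>i\<in>I. w i * Y i \<omega>"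
  let ?S2 = "\<lambda>\<omega>. \<Sum>i\<in>I. (w i)\<^sup>2 * ((Y i \<omega>)\<^sup>2 - 1)"
  let ?T = "\<lambda>\<omega>. \<Sum>i\<in>I. \<bar>d i\<bar> * \<bar>Y i \<omega>\<bar>"
  let ?E = "\<lambda>\<omega>. local_var l (\<lambda>i. m + d i + w i * Y i \<omega>) j - 1 / l * (\<Sum>i\<in>I. (w i)\<^sup>2)"
  have D: "D \<ge> 0" using d by (meson order_trans sum_nonneg abs_ge_zero)
  have meas [measurable]: "(\<lambda>\<omega>. local_var l (\<lambda>i. m + d i + w i * Y i \<omega>) j) \<in> borel_measurable M"
    unfolding local_var_def local_mean_def using Y by (auto simp: I_def intro!: borel_measurable_sum
      borel_measurable_times borel_measurable_add borel_measurable_diff borel_measurable_power)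
  let ?B = "\<lambda>\<omega>. ((?S2 \<omega>)\<^sup>2 / sqrt l + sqrt l) / (2 * real l) + 2 * A * ?T \<omega> / l + 3 * D\<^sup>2 / l
    + 2 * (?S1 \<omega>)\<^sup>2 / (real l)\<^sup>2"
  have le: "\<bar>?E \<omega>\<bar> \<le> ?B \<omega>" for \<omega>
    using local_var_error_le[OF l j, of w A d D m "\<lambda>i. Y i \<omega>"] w d unfolding I_def by blast
  have iT: "integrable M ?T" using i1 by auto
  have iB: "integrable M ?B" using iT iS1 iS2 by simp
  have iE: "integrable M ?E"
    by (rule Bochner_Integration.integrable_bound[OF iB]) (use le in \<open>auto intro: order_trans[OF _ abs_ge_self]\<close>)
  then have "integrable M (\<lambda>\<omega>. ?E \<omega> + 1 / l * (\<Sum>i\<in>I. (w i)\<^sup>2))"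
    by (intro Bochner_Integration.integrable_add integrable_const)
  then show "integrable M (\<lambda>\<omega>. local_var l (\<lambda>i. m + d i + w i * Y i \<omega>) j)" by simp
  have lpos: "real l \<ge> 1" "sqrt l > 0" using l by auto
  have sl: "sqrt l \<le> l" using lpos mult_left_mono[of 1 "sqrt l" "sqrt l"] by simp
  have eT: "expectation ?T \<le> D * m1"
  proof -
    have "expectation ?T = (\<Sum>i\<in>I. \<bar>d i\<bar> * expectation (\<lambda>\<omega>. \<bar>Y i \<omega>\<bar>))"
      using i1 by (simp add: Bochner_Integration.integral_sum)
    also have "\<dots> \<le> (\<Sum>i\<in>I. \<bar>d i\<bar> * m1)"
      using m1 by (intro sum_mono mult_left_mono) auto
    also have "\<dots> \<le> D * m1" using d nonneg by (simp add: sum_distrib_right[symmetric] mult_right_mono)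
    finally show ?thesis .
  qed
  have "expectation (\<lambda>\<omega>. \<bar>?E \<omega>\<bar>) \<le> expectation ?B"
    using iE iB le by (intro integral_mono) auto
  also have "\<dots> = (expectation (\<lambda>\<omega>. (?S2 \<omega>)\<^sup>2) / sqrt l + sqrt l) / (2 * real l) + 2 * A * expectation ?T / l
     + 3 * D\<^sup>2 / l + 2 * expectation (\<lambda>\<omega>. (?S1 \<omega>)\<^sup>2) / (real l)\<^sup>2"
    using iT iS1 iS2 by (simp add: prob_space)
  also have "\<dots> \<le> (C2 * (A\<^sup>2)\<^sup>2 * l / sqrt l + sqrt l) / (2 * real l) + 2 * A * (D * m1) / l
     + 3 * D\<^sup>2 / l + 2 * (C1 * A\<^sup>2 * l) / (real l)\<^sup>2"
    using S1 S2 eT A lpos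
    by (intro add_mono divide_right_mono mult_left_mono order_refl) auto
  also have "\<dots> = (C2 * (A\<^sup>2)\<^sup>2 + 1) / 2 / sqrt l + (2 * A * D * m1 + 3 * D\<^sup>2 + 2 * C1 * A\<^sup>2) / l"
  proof -
    have 1: "(C2 * (A\<^sup>2)\<^sup>2 * l / sqrt l + sqrt l) / (2 * real l) = (C2 * (A\<^sup>2)\<^sup>2 + 1) / 2 / sqrt l"
    proof -
      define r where "r = sqrt l"
      have r: "r > 0" "real l = r * r" using lpos by (simp_all add: r_def)
      show ?thesis unfolding r_def[symmetric] unfolding r(2) using r(1) by (simp add: field_simps)
    qed
    have 2: "2 * (C1 * A\<^sup>2 * l) / (real l)\<^sup>2 = 2 * C1 * A\<^sup>2 / l"
      using lpos by (simp add: power2_eq_square)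
    show ?thesis unfolding 1 2 by (simp add: add_divide_distrib mult.assoc)
  qed
  also have "\<dots> \<le> (C2 * (A\<^sup>2)\<^sup>2 + 1) / 2 / sqrt l + (2 * A * D * m1 + 3 * D\<^sup>2 + 2 * C1 * A\<^sup>2) / sqrt l"
    using lpos sl A D nonneg by (intro add_left_mono divide_left_mono) auto
  also have "\<dots> = ((C2 * (A\<^sup>2)\<^sup>2 + 1) / 2 + 2 * A * D * m1 + 3 * D\<^sup>2 + 2 * C1 * A\<^sup>2) / sqrt l"
    by (simp add: add_divide_distrib)
  finally show "expectation (\<lambda>\<omega>. \<bar>?E \<omega>\<bar>)
      \<le> ((C2 * (A\<^sup>2)\<^sup>2 + 1) / 2 + 2 * A * D * m1 + 3 * D\<^sup>2 + 2 * C1 * A\<^sup>2) / sqrt l" .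
qed

section \<open>Riemann sums for piecewise Lipschitz functions\<close>

text \<open>Multiply by \<open>sqrt a + sqrt b\<close>, which is at least \<open>r\<close> by the
  bound on \<open>b\<close> alone. The asymmetry is essential: \<open>a\<close> will come from
  empirical variances, which can be arbitrarily close to \<open>0\<close>.\<close>

lemma abs_sqrt_diff_le:
  assumes "a \<ge> 0" "b \<ge> r\<^sup>2" "r > 0"
  shows "\<bar>sqrt a - sqrt b\<bar> \<le> \<bar>a - b\<bar> / r"
proof -
  have b: "b \<ge> 0" "sqrt b \<ge> r"
    using order_trans[OF zero_le_power2 assms(2)] assms real_le_rsqrt by auto
  have "(sqrt a - sqrt b) * (sqrt a + sqrt b) = a - b"
    using assms b by (simp add: algebra_simps)
  then have "\<bar>a - b\<bar> = \<bar>sqrt a - sqrt b\<bar> * (sqrt a + sqrt b)"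
    using assms b by (metis abs_mult abs_of_nonneg add_nonneg_nonneg real_sqrt_ge_zero)
  also have "\<dots> \<ge> \<bar>sqrt a - sqrt b\<bar> * r"
    using assms b by (intro mult_left_mono) (auto intro: add_increasing)
  finally show ?thesis using assms by (simp add: pos_le_divide_eq)
qed

text \<open>Off \<open>T\<close>, the value \<open>h x\<close> depends only on the set
  \<open>T \<inter> {..x}\<close>: two points off \<open>T\<close> with the same set have no point
  of \<open>T\<close> between them. There are finitely many such sets, \<open>g\<close> selects a
  representative for each, and \<open>T\<close> itself adds finitely many values. The purpose is
  boundedness of \<open>h\<close>.\<close>

lemma piecewise_constant01_finite_range:
  assumes "piecewise_constant01 h"
  shows "finite (h ` {0..1})"
proof -
  obtain T where T: "finite T"
    and h: "\<And>x y. x \<in> {0..1} \<Longrightarrow> y \<in> {0..1} \<Longrightarrow> x \<le> y \<Longrightarrow> {x..y} \<inter> T = {} \<Longrightarrow> h x = h y"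
    using assms unfolding piecewise_constant01_def by blast
  define S where "S = {0..1} - T"
  define g where "g = inv_into S (\<lambda>x. T \<inter> {..x})"
  have eq: "h x = h (g (T \<inter> {..x}))" if "x \<in> S" for x
  proof -
    define y where "y = g (T \<inter> {..x})"
    have y: "y \<in> S" "T \<inter> {..y} = T \<inter> {..x}"
      using that unfolding y_def g_def
      by (auto intro!: inv_into_into f_inv_into_f[of _ "\<lambda>x. T \<inter> {..x}"])
    have disj: "{u..v} \<inter> T = {}" if uv: "u \<in> S" "T \<inter> {..u} = T \<inter> {..v}" for u v
    proof (rule ccontr)
      assume "{u..v} \<inter> T \<noteq> {}"
      then obtain t where t: "t \<in> T" "u \<le> t" "t \<le> v" by auto
      then have "t \<in> T \<inter> {..u}" unfolding uv(2) by auto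
      then show False using t uv(1) by (auto simp: S_def)
    qed
    have xy: "x \<in> {0..1}" "y \<in> {0..1}" using y(1) that by (auto simp: S_def)
    have "h x = h y"
    proof (cases "x \<le> y")
      case True
      show ?thesis by (rule h[OF xy True disj[OF that y(2)[symmetric]]])
    next
      case False
      then show ?thesis by (intro h[OF xy(2,1) _ disj[OF y], symmetric]) simp
    qed
    then show ?thesis by (simp add: y_def)
  qed
  have "h ` {0..1} \<subseteq> h ` T \<union> (\<lambda>U. h (g U)) ` Pow T"
  proof (rule image_subsetI)
    fix x :: real assume "x \<in> {0..1}"
    then consider "x \<in> T" | "x \<in> S" by (auto simp: S_def)
    then show "h x \<in> h ` T \<union> (\<lambda>U. h (g U)) ` Pow T"
    proof cases
      case 2
      show ?thesis by (rule UnI2, rule image_eqI[of _ _ "T \<inter> {..x}"])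
        (use eq[OF 2] in simp_all)
    qed simp
  qed
  then show ?thesis using T by (meson finite_UnI finite_Pow_iff finite_imageI finite_subset)
qed

text \<open>The form in which the hypothesis on \<sigma> is used. The bound adds the Lipschitz part,
  controlled from its value at \<open>0\<close>, to the finite range of the step part; on an
  interval without a point of \<open>T\<close> the step part cancels.\<close>

lemma piecewise_lipschitz01E:
  assumes "piecewise_lipschitz01 f"
  obtains A L T where "A \<ge> 0" "L \<ge> 0" "finite T" "\<And>x. x \<in> {0..1} \<Longrightarrow> \<bar>f x\<bar> \<le> A"
    "\<And>x y. x \<in> {0..1} \<Longrightarrow> y \<in> {0..1} \<Longrightarrow> x \<le> y \<Longrightarrow> {x..y} \<inter> T = {} \<Longrightarrow> \<bar>f x - f y\<bar> \<le> L * (y - x)"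
proof -
  obtain g h L where g: "L-lipschitz_on {0..1} g" and h: "piecewise_constant01 h"
    and f: "\<And>x. x \<in> {0..1} \<Longrightarrow> f x = g x + h x"
    using assms unfolding piecewise_lipschitz01_def by blast
  obtain T where T: "finite T"
    and hT: "\<And>x y. x \<in> {0..1} \<Longrightarrow> y \<in> {0..1} \<Longrightarrow> x \<le> y \<Longrightarrow> {x..y} \<inter> T = {} \<Longrightarrow> h x = h y"
    using h unfolding piecewise_constant01_def by blast
  have L: "L \<ge> 0" by (rule lipschitz_on_nonneg[OF g])
  obtain B where B: "\<forall>x\<in>{0..1}. \<bar>h x\<bar> \<le> B"
    using finite_imp_bounded[OF piecewise_constant01_finite_range[OF h]]
    unfolding bounded_iff by auto
  have gL: "\<bar>g x - g y\<bar> \<le> L * \<bar>x - y\<bar>" if "x \<in> {0..1}" "y \<in> {0..1}" for x y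
    using lipschitz_onD[OF g that] by (simp add: dist_real_def)
  show ?thesis
  proof (rule that[of "\<bar>g 0\<bar> + L + \<bar>B\<bar>" L T])
    show "\<bar>f x\<bar> \<le> \<bar>g 0\<bar> + L + \<bar>B\<bar>" if x: "x \<in> {0..1}" for x
    proof -
      have "L * \<bar>x - 0\<bar> \<le> L * 1" using x L by (intro mult_left_mono) auto
      then show ?thesis using gL[OF x, of 0] bspec[OF B x] f[OF x] by auto
    qed
    show "\<bar>f x - f y\<bar> \<le> L * (y - x)"
      if "x \<in> {0..1}" "y \<in> {0..1}" "x \<le> y" "{x..y} \<inter> T = {}" for x y
      using gL[OF that(1,2)] hT[OF that] f[OF that(1)] f[OF that(2)] that(3) by simp
  qed (use L T in auto)
qed

text \<open>The function is continuous off the finite set \<open>T'\<close>. The points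
  \<open>0\<close> and \<open>1\<close> are added to \<open>T\<close> because cutting off outside
  \<open>[0,1]\<close> may create jumps there.\<close>

lemma piecewise_lipschitz01_measurable:
  assumes "piecewise_lipschitz01 f"
  shows "(\<lambda>x. indicator {0..1} x * f x) \<in> borel_measurable borel"
proof -
  obtain A L T where L: "L \<ge> 0" and T: "finite T"
    and f: "\<And>x y. x \<in> {0..1} \<Longrightarrow> y \<in> {0..1} \<Longrightarrow> x \<le> y \<Longrightarrow> {x..y} \<inter> T = {} \<Longrightarrow> \<bar>f x - f y\<bar> \<le> L * (y - x)"
    using piecewise_lipschitz01E[OF assms] by metis
  define T' where "T' = insert 0 (insert 1 T)"
  show ?thesis
  proof (rule borel_measurable_continuous_countable_exceptions[of T'])
    show "countable T'" using T by (auto simp: T'_def intro: countable_finite)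
    have open_T': "open (- T')" using T by (auto simp: T'_def intro!: open_Compl finite_imp_closed)
    show "continuous_on (- T') (\<lambda>x. indicator {0..1} x * f x)"
    proof (rule continuous_at_imp_continuous_on, rule ballI)
      fix x assume x: "x \<in> - T'"
      obtain e where e: "e > 0" "ball x e \<subseteq> - T'" using open_T' x by (meson open_contains_ball)
      show "isCont (\<lambda>x. indicator {0..1} x * f x) x"
      proof (cases "x \<in> {0..1}")
        case False
        have "\<forall>\<^sub>F y in nhds x. y \<in> - {0..1}"
          using False by (intro eventually_nhds_in_open) auto
        then have "\<forall>\<^sub>F y in nhds x. indicator {0..1} y * f y = 0" by eventually_elim auto
        then show ?thesis by (subst isCont_cong[where g = "\<lambda>_. 0"]) auto
      next
        case True
        have in01: "y \<in> {0..1}" if "y \<in> ball x e" for y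
        proof (rule ccontr)
          assume "y \<notin> {0..1}"
          then have "0 \<in> ball x e \<or> 1 \<in> ball x e" using that True by (auto simp: dist_real_def)
          then show False
            using subsetD[OF e(2), of 0] subsetD[OF e(2), of 1] by (auto simp: T'_def)
        qed
        have bd: "\<bar>f y - f x\<bar> \<le> L * \<bar>y - x\<bar>" if y: "y \<in> ball x e" for y
        proof (cases "x \<le> y")
          case True
          then have "{x..y} \<subseteq> ball x e" using y by (auto simp: dist_real_def)
          then have "{x..y} \<inter> T = {}" using e(2) by (auto simp: T'_def)
          then show ?thesis using f[of x y] in01[OF y] \<open>x \<in> {0..1}\<close> True by (simp add: abs_minus_commute)
        next
          case False
          then have "{y..x} \<subseteq> ball x e" using y by (auto simp: dist_real_def)
          then have "{y..x} \<inter> T = {}" using e(2) by (auto simp: T'_def)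
          then show ?thesis using f[of y x] in01[OF y] \<open>x \<in> {0..1}\<close> False by simp
        qed
        have ev: "\<forall>\<^sub>F y in at x. y \<in> ball x e"
          using e(1) by (intro eventually_at_in_open') auto
        have "((\<lambda>y. L * \<bar>y - x\<bar>) \<longlongrightarrow> L * \<bar>x - x\<bar>) (at x)" by (intro tendsto_intros)
        then have "((\<lambda>y. L * \<bar>y - x\<bar>) \<longlongrightarrow> 0) (at x)" by simp
        then have "((\<lambda>y. f y - f x) \<longlongrightarrow> 0) (at x)"
        proof (rule Lim_null_comparison[rotated])
          show "\<forall>\<^sub>F y in at x. norm (f y - f x) \<le> L * \<bar>y - x\<bar>"
            using ev by (rule eventually_mono) (use bd in \<open>simp only: real_norm_def\<close>)
        qed
        then have "(f \<longlongrightarrow> f x) (at x)" by (rule LIM_zero_cancel)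
        moreover have eq: "\<forall>\<^sub>F y in at x. indicator {0..1} y * f y = f y"
          using ev by eventually_elim (use in01 in auto)
        ultimately have "((\<lambda>x. indicator {0..1} x * f x) \<longlongrightarrow> f x) (at x)"
          by (simp only: tendsto_cong[OF eq])
        then show ?thesis using True by (simp add: isCont_def)
      qed
    qed
  qed
qed

text \<open>A point \<open>t\<close> lies in the closed block \<open>j\<close> only if
  \<open>j - 1 \<le> t * b \<le> j\<close>, which leaves the ceiling of \<open>t * b\<close> and, if
  \<open>t * b\<close> is an integer, its successor: a jump at a common end point affects both
  neighbours.\<close>

lemma card_jump_blocks:
  assumes "finite T" "b \<ge> 1"
  shows "card {j \<in> {1..b}. {(real j - 1) / b..real j / b} \<inter> T \<noteq> {}} \<le> 2 * card T"
proof -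
  have sub: "{j \<in> {1..b}. {(real j - 1) / b..real j / b} \<inter> T \<noteq> {}}
      \<subseteq> (\<Union>t\<in>T. {nat \<lceil>t * b\<rceil>, nat \<lceil>t * b\<rceil> + 1})"
  proof (rule subsetI)
    fix j assume "j \<in> {j \<in> {1..b}. {(real j - 1) / b..real j / b} \<inter> T \<noteq> {}}"
    then obtain t where j: "j \<in> {1..b}" and t: "t \<in> {(real j - 1) / b..real j / b}" "t \<in> T" by blast
    have "real j - 1 \<le> t * b" "t * b \<le> real j" using t assms by (auto simp: field_simps)
    then have "\<lceil>t * b\<rceil> \<le> int j" "int j - 1 \<le> \<lceil>t * b\<rceil>" by linarith+
    then have "j = nat \<lceil>t * b\<rceil> \<or> j = nat \<lceil>t * b\<rceil> + 1" using j by auto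
    then show "j \<in> (\<Union>t\<in>T. {nat \<lceil>t * b\<rceil>, nat \<lceil>t * b\<rceil> + 1})" using t by auto
  qed
  have "card {j \<in> {1..b}. {(real j - 1) / b..real j / b} \<inter> T \<noteq> {}}
      \<le> card (\<Union>t\<in>T. {nat \<lceil>t * b\<rceil>, nat \<lceil>t * b\<rceil> + 1})"
    using assms by (intro card_mono sub) auto
  also have "\<dots> \<le> (\<Sum>t\<in>T. card {nat \<lceil>t * b\<rceil>, nat \<lceil>t * b\<rceil> + 1})"
    by (rule card_UN_le) fact
  also have "\<dots> \<le> (\<Sum>t\<in>T. 2)" by (intro sum_mono) auto
  finally show ?thesis by simp
qed

text \<open>The intervals are half-open so that they partition \<open>(0, 1]\<close> and at most one
  summand is nonzero; the point \<open>0\<close> that is lost is a null set.\<close>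

definition block_step :: "nat \<Rightarrow> (nat \<Rightarrow> real) \<Rightarrow> real \<Rightarrow> real" where
  "block_step b v x = (\<Sum>j\<in>{1..b}. v j * indicator {(real j - 1) / b<..real j / b} x)"

lemma block_step_measurable [measurable]: "block_step b v \<in> borel_measurable borel"
  unfolding block_step_def by measurable

lemma block_step_integral:
  assumes "b \<ge> 1"
  shows "integrable lborel (block_step b v)"
    and "(\<integral>x. block_step b v x \<partial>lborel) = (\<Sum>j\<in>{1..b}. v j) / b"
proof -
  have i: "integrable lborel (\<lambda>x. v j * indicator {(real j - 1) / b<..real j / b} x)"
    "(\<integral>x. v j * indicator {(real j - 1) / b<..real j / b} x \<partial>lborel) = v j / b" for j
    using assms by (auto simp: divide_right_mono diff_divide_distrib)
  show "integrable lborel (block_step b v)"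
    unfolding block_step_def by (intro Bochner_Integration.integrable_sum i)
  show "(\<integral>x. block_step b v x \<partial>lborel) = (\<Sum>j\<in>{1..b}. v j) / b"
    unfolding block_step_def by (subst Bochner_Integration.integral_sum) (simp_all only: i sum_divide_distrib)
qed

lemma block_step_eq:
  assumes "b \<ge> 1" "j \<in> {1..b}" "x \<in> {(real j - 1) / b<..real j / b}"
  shows "block_step b v x = v j"
proof -
  have uniq: "k = j" if "k \<in> {1..b}" "x \<in> {(real k - 1) / b<..real k / b}" for k
  proof -
    have "real k - 1 < x * b" "x * b \<le> k" "real j - 1 < x * b" "x * b \<le> j"
      using that assms by (auto simp: field_simps)
    then show ?thesis by linarith
  qed
  have "block_step b v x = (\<Sum>k\<in>{1..b}. if k = j then v j else 0)"
    unfolding block_step_def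
  proof (intro sum.cong refl)
    fix k assume "k \<in> {1..b}"
    then show "v k * indicator {(real k - 1) / b<..real k / b} x = (if k = j then v j else 0)"
      using uniq[of k] assms(3) by (cases "k = j") (auto simp: indicator_def)
  qed
  then show ?thesis using assms by simp
qed

lemma block_exists:
  assumes "b \<ge> 1" "x \<in> {0<..1}"
  obtains j where "j \<in> {1..b}" "x \<in> {(real j - 1) / b<..real j / b}"
proof
  have x: "0 < x * b" "x * b \<le> b" using assms by auto
  show "nat \<lceil>x * b\<rceil> \<in> {1..b}" using x by (auto simp: ceiling_le_iff Suc_le_eq)
  have "real (nat \<lceil>x * b\<rceil>) = of_int \<lceil>x * b\<rceil>" using x by simp
  then have "real (nat \<lceil>x * b\<rceil>) - 1 < x * b" "x * b \<le> real (nat \<lceil>x * b\<rceil>)" by linarith+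
  then show "x \<in> {(real (nat \<lceil>x * b\<rceil>) - 1) / b<..real (nat \<lceil>x * b\<rceil>) / b}"
    using assms by (auto simp: field_simps)
qed

lemma block_step_outside:
  assumes "b \<ge> 1" "x \<notin> {0<..1}"
  shows "block_step b v x = 0"
proof -
  have "x \<notin> {(real j - 1) / b<..real j / b}" if "j \<in> {1..b}" for j
  proof
    assume "x \<in> {(real j - 1) / b<..real j / b}"
    moreover have "0 \<le> (real j - 1) / b" "real j / b \<le> 1" using that assms by auto
    ultimately show False using assms(2) by auto
  qed
  then show ?thesis unfolding block_step_def by (intro sum.neutral) (auto simp: indicator_def)
qed

text \<open>The block average is the integral of \<open>block_step b v\<close>, and
  \<open>block_step b e\<close> dominates the difference almost everywhere. Errors may depend on the
  block, so that a few blocks with jumps can be charged more than the others.\<close>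

lemma block_integral_error:
  fixes F :: "real \<Rightarrow> real"
  assumes b: "b \<ge> 1" and F: "set_integrable lborel {0..1} F"
    and e: "\<And>j x. j \<in> {1..b} \<Longrightarrow> x \<in> {(real j - 1) / b..real j / b} \<Longrightarrow> \<bar>F x - v j\<bar> \<le> e j"
  shows "\<bar>(LBINT x:{0..1}. F x) - (\<Sum>j\<in>{1..b}. v j) / b\<bar> \<le> (\<Sum>j\<in>{1..b}. e j) / b"
proof -
  have iF: "integrable lborel (\<lambda>x. indicator {0..1} x * F x)"
    using F by (simp add: set_integrable_def)
  note st = block_step_integral[OF b]
  have "\<bar>(LBINT x:{0..1}. F x) - (\<Sum>j\<in>{1..b}. v j) / b\<bar>
     = \<bar>\<integral>x. indicator {0..1} x * F x - block_step b v x \<partial>lborel\<bar>"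
    using iF st by (simp add: set_lebesgue_integral_def)
  also have "\<dots> \<le> (\<integral>x. \<bar>indicator {0..1} x * F x - block_step b v x\<bar> \<partial>lborel)"
    by (rule integral_abs_bound)
  also have "\<dots> \<le> (\<integral>x. block_step b e x \<partial>lborel)"
  proof (rule integral_mono_AE)
    have "AE x in lborel. x \<noteq> (0::real)" by (rule AE_lborel_singleton)
    then show "AE x in lborel. \<bar>indicator {0..1} x * F x - block_step b v x\<bar> \<le> block_step b e x"
    proof eventually_elim
      fix x :: real assume x: "x \<noteq> 0"
      show "\<bar>indicator {0..1} x * F x - block_step b v x\<bar> \<le> block_step b e x"
      proof (cases "x \<in> {0<..1}")
        case False
        then show ?thesis using x b by (auto simp: block_step_outside indicator_def)
      next
        case True
        then obtain j where j: "j \<in> {1..b}" "x \<in> {(real j - 1) / b<..real j / b}"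
          using block_exists[OF b] by blast
        then show ?thesis using True block_step_eq[OF b j] e[of j x] by auto
      qed
    qed
  qed (intro iF st(1) integrable_abs Bochner_Integration.integrable_diff)+
  finally show ?thesis using st by simp
qed

lemma abs_sqrt_add_diff_le:
  assumes "a \<ge> 0" "b \<ge> r\<^sup>2" "r > 0" "c \<ge> 0"
  shows "\<bar>sqrt (a + c) - sqrt (b + c)\<bar> \<le> \<bar>a - b\<bar> / r"
  using abs_sqrt_diff_le[of "a + c" r "b + c"] assms by simp

text \<open>The one-dimensional estimate is applied in \<open>y\<close> for fixed \<open>x\<close>
  and then in \<open>x\<close>. Replacing \<open>q\<close> by \<open>v\<close> in either variable
  turns an error \<open>e j\<close> into \<open>e j / r\<close> for the square root, and averaging
  over blocks makes the two contributions equal: hence the factor \<open>2\<close>.\<close>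

lemma block_double_integral_error:
  fixes q :: "real \<Rightarrow> real"
  assumes b: "b \<ge> 1" and r: "r > 0"
    and q: "\<And>x. x \<in> {0..1} \<Longrightarrow> 0 \<le> q x \<and> q x \<le> B"
    and qm: "(\<lambda>x. indicator {0..1} x * q x) \<in> borel_measurable borel"
    and v: "\<And>j. j \<in> {1..b} \<Longrightarrow> r\<^sup>2 \<le> v j"
    and e: "\<And>j x. j \<in> {1..b} \<Longrightarrow> x \<in> {(real j - 1) / b..real j / b} \<Longrightarrow> \<bar>q x - v j\<bar> \<le> e j"
  shows "\<bar>(LBINT x:{0..1}. LBINT y:{0..1}. sqrt (q x + q y))
      - (\<Sum>j\<in>{1..b}. \<Sum>k\<in>{1..b}. sqrt (v j + v k)) / (real b)\<^sup>2\<bar>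
     \<le> 2 * (\<Sum>j\<in>{1..b}. e j) / (b * r)"
proof -
  define p where "p x = indicator {0..1} x * q x" for x :: real
  have [measurable]: "p \<in> borel_measurable borel" using qm unfolding p_def .
  have v0: "v j \<ge> 0" if "j \<in> {1..b}" for j
    using order_trans[OF zero_le_power2 v[OF that]] .
  have in01: "x \<in> {0..1}" if "j \<in> {1..b}" "x \<in> {(real j - 1) / b..real j / b}" for j x
  proof -
    have "0 \<le> (real j - 1) / b" "real j / b \<le> 1" using that(1) by auto
    then show ?thesis using that(2) by auto
  qed
  have int: "set_integrable lborel {0..1} F"
    if "(\<lambda>x. indicator {0..1} x * F x) \<in> borel_measurable borel" "\<And>x. x \<in> {0..1} \<Longrightarrow> \<bar>F x\<bar> \<le> C"
    for F :: "real \<Rightarrow> real" and C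
    unfolding set_integrable_def
  proof (rule Bochner_Integration.integrable_bound[where f = "\<lambda>x. indicator {0..1} x * C"])
    show "AE x in lborel. norm (indicator {0..1} x *\<^sub>R F x) \<le> norm (indicator {0..1} x * C)"
      by (rule AE_I2) (use that(2) in \<open>force simp: indicator_def\<close>)
  qed (use that(1) in auto)
  have inner_meas: "(\<lambda>y. indicator {0..1} y * sqrt (c + q y)) \<in> borel_measurable borel" for c
  proof -
    have "(\<lambda>y. indicator {0..1} y * sqrt (c + q y)) = (\<lambda>y. indicator {0..1} y * sqrt (c + p y))"
      by (auto simp: p_def indicator_def)
    then show ?thesis by simp
  qed
  have inner_int: "set_integrable lborel {0..1} (\<lambda>y. sqrt (c + q y))" if "c \<ge> 0" for c
    by (rule int[OF inner_meas, of _ "sqrt (c + B)"]) (use q that in auto)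
  define G where "G x = (LBINT y:{0..1}. sqrt (q x + q y))" for x
  have G_inner: "\<bar>G x - (\<Sum>k\<in>{1..b}. sqrt (q x + v k)) / b\<bar> \<le> (\<Sum>k\<in>{1..b}. e k / r) / b"
    if x: "x \<in> {0..1}" for x
    unfolding G_def
  proof (rule block_integral_error[OF b inner_int])
    show "0 \<le> q x" using q[OF x] by simp
    fix k y assume k: "k \<in> {1..b}" and y: "y \<in> {(real k - 1) / b..real k / b}"
    have "\<bar>sqrt (q y + q x) - sqrt (v k + q x)\<bar> \<le> \<bar>q y - v k\<bar> / r"
      using q[OF in01[OF k y]] q[OF x] v[OF k] r by (intro abs_sqrt_add_diff_le) auto
    also have "\<dots> \<le> e k / r" using e[OF k y] r by (intro divide_right_mono) auto
    finally show "\<bar>sqrt (q x + q y) - sqrt (q x + v k)\<bar> \<le> e k / r" by (simp add: add.commute)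
  qed
  let ?S = "\<Sum>k\<in>{1..b}. e k"
  have G_block: "\<bar>G x - (\<Sum>k\<in>{1..b}. sqrt (v j + v k)) / b\<bar> \<le> ?S / (b * r) + e j / r"
    if j: "j \<in> {1..b}" and x: "x \<in> {(real j - 1) / b..real j / b}" for j x
  proof -
    have "\<bar>(\<Sum>k\<in>{1..b}. sqrt (q x + v k)) / b - (\<Sum>k\<in>{1..b}. sqrt (v j + v k)) / b\<bar>
        = \<bar>\<Sum>k\<in>{1..b}. sqrt (q x + v k) - sqrt (v j + v k)\<bar> / b"
      by (simp add: sum_subtractf diff_divide_distrib[symmetric] abs_divide)
    also have "\<dots> \<le> (\<Sum>k\<in>{1..b}. \<bar>sqrt (q x + v k) - sqrt (v j + v k)\<bar>) / b"
      by (intro divide_right_mono sum_abs) auto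
    also have "\<dots> \<le> (\<Sum>k\<in>{1..b}. e j / r) / b"
    proof (intro divide_right_mono sum_mono)
      fix k assume k: "k \<in> {1..b}"
      have "\<bar>sqrt (q x + v k) - sqrt (v j + v k)\<bar> \<le> \<bar>q x - v j\<bar> / r"
        using q[OF in01[OF j x]] v[OF j] v0[OF k] r by (intro abs_sqrt_add_diff_le) auto
      also have "\<dots> \<le> e j / r" using e[OF j x] r by (intro divide_right_mono) auto
      finally show "\<bar>sqrt (q x + v k) - sqrt (v j + v k)\<bar> \<le> e j / r" .
    qed simp
    also have "\<dots> = e j / r" using b by simp
    finally have 1: "\<bar>(\<Sum>k\<in>{1..b}. sqrt (q x + v k)) / b - (\<Sum>k\<in>{1..b}. sqrt (v j + v k)) / b\<bar> \<le> e j / r" .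
    have "(\<Sum>k\<in>{1..b}. e k / r) / b = ?S / (b * r)"
      by (simp add: sum_divide_distrib[symmetric] mult.commute)
    then show ?thesis using G_inner[OF in01[OF j x]] 1 by linarith
  qed
  have G_int: "set_integrable lborel {0..1} G"
  proof (rule int)
    \<comment> \<open>Replacing \<open>q\<close> by its cut-off version \<open>p\<close> changes
      nothing on the domain of integration and makes the integrand jointly Borel measurable, so the
      parameter integral is measurable in \<open>x\<close>.\<close>
    have "(\<lambda>x. indicator {0..1} x * G x)
      = (\<lambda>x. indicator {0..1} x * (\<integral>y. indicator {0..1} y * sqrt (p x + p y) \<partial>lborel))"
      unfolding G_def set_lebesgue_integral_def
      by (intro ext) (auto simp: p_def indicator_def intro!: Bochner_Integration.integral_cong)
    then show "(\<lambda>x. indicator {0..1} x * G x) \<in> borel_measurable borel" by simp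
    fix x :: real assume x: "x \<in> {0..1}"
    have "\<bar>G x\<bar> \<le> (\<integral>y. \<bar>indicator {0..1} y * sqrt (q x + q y)\<bar> \<partial>lborel)"
      unfolding G_def set_lebesgue_integral_def real_scaleR_def by (rule integral_abs_bound)
    also have "\<dots> \<le> (\<integral>y. indicator {0..1::real} y * sqrt (B + B) \<partial>lborel)"
    proof (rule Bochner_Integration.integral_mono)
      show "integrable lborel (\<lambda>y. \<bar>indicator {0..1} y * sqrt (q x + q y)\<bar>)"
        using inner_int[of "q x"] q[OF x] by (simp add: set_integrable_def)
      show "integrable lborel (\<lambda>y. indicator {0..1::real} y * sqrt (B + B))" by simp
      fix y
      show "\<bar>indicator {0..1} y * sqrt (q x + q y)\<bar> \<le> indicator {0..1} y * sqrt (B + B)"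
        using q[OF x] q[of y] by (auto simp: indicator_def)
    qed
    also have "\<dots> = sqrt (B + B)" by simp
    finally show "\<bar>G x\<bar> \<le> sqrt (B + B)" .
  qed
  have "\<bar>(LBINT x:{0..1}. G x) - (\<Sum>j\<in>{1..b}. (\<Sum>k\<in>{1..b}. sqrt (v j + v k)) / b) / b\<bar>
     \<le> (\<Sum>j\<in>{1..b}. ?S / (b * r) + e j / r) / b"
    by (rule block_integral_error[OF b G_int G_block])
  also have "(\<Sum>j\<in>{1..b}. ?S / (b * r) + e j / r) / b = 2 * ?S / (b * r)"
  proof -
    have "(\<Sum>j\<in>{1..b}. ?S / (b * r) + e j / r) = ?S / r + ?S / r"
      using b by (simp add: sum.distrib sum_divide_distrib[symmetric])
    then show ?thesis by (simp add: mult.commute add_divide_distrib[symmetric])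
  qed
  also have "(\<Sum>j\<in>{1..b}. (\<Sum>k\<in>{1..b}. sqrt (v j + v k)) / b) / b
      = (\<Sum>j\<in>{1..b}. \<Sum>k\<in>{1..b}. sqrt (v j + v k)) / (real b)\<^sup>2"
    by (simp add: sum_divide_distrib[symmetric] power2_eq_square)
  finally show ?thesis unfolding G_def .
qed

section \<open>Averages over ordered pairs of distinct blocks\<close>

definition off_diagonal :: "nat \<Rightarrow> (nat \<times> nat) set" where
  "off_diagonal b = {(j, k). j \<in> {1..b} \<and> k \<in> {1..b} \<and> j \<noteq> k}"

lemma sum_off_diagonal:
  "(\<Sum>(j, k)\<in>off_diagonal b. f j k) = (\<Sum>j\<in>{1..b}. \<Sum>k\<in>{1..b} - {j}. f j k)"
proof -
  have "off_diagonal b = Sigma {1..b} (\<lambda>j. {1..b} - {j})" by (auto simp: off_diagonal_def)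
  then show ?thesis by (simp add: sum.Sigma)
qed

lemma sum_off_diagonal_fst_snd:
  fixes g :: "nat \<Rightarrow> real"
  assumes "b \<ge> 1"
  shows "(\<Sum>(j, k)\<in>off_diagonal b. g j + g k) = 2 * (real b - 1) * (\<Sum>j\<in>{1..b}. g j)"
proof -
  have "(\<Sum>(j, k)\<in>off_diagonal b. g j + g k) = (\<Sum>j\<in>{1..b}. (real b - 1) * g j + ((\<Sum>k\<in>{1..b}. g k) - g j))"
    unfolding sum_off_diagonal
  proof (rule sum.cong[OF refl])
    fix j assume j: "j \<in> {1..b}"
    have "(\<Sum>k\<in>{1..b} - {j}. g k) = (\<Sum>k\<in>{1..b}. g k) - g j" using j by (simp add: sum_diff1)
    moreover have "real (card ({1..b} - {j})) = real b - 1" using j assms by (simp add: of_nat_diff)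
    ultimately show "(\<Sum>k\<in>{1..b} - {j}. g j + g k) = (real b - 1) * g j + ((\<Sum>k\<in>{1..b}. g k) - g j)"
      by (simp add: sum.distrib)
  qed
  also have "\<dots> = (real b - 1) * (\<Sum>j\<in>{1..b}. g j) + (b * (\<Sum>k\<in>{1..b}. g k) - (\<Sum>j\<in>{1..b}. g j))"
    by (simp add: sum.distrib sum_subtractf sum_distrib_left)
  finally show ?thesis by (simp add: algebra_simps)
qed

text \<open>A block occurs in \<open>2 * (b - 1)\<close> of the \<open>b * (b - 1)\<close> ordered
  pairs, so its error enters with weight \<open>2 / b\<close>: the pair average is off by at most a
  multiple of the mean block error. Only \<open>v\<close> has to stay away from
  \<open>0\<close>.\<close>

lemma pair_average_lipschitz:
  fixes u v :: "nat \<Rightarrow> real"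
  assumes b: "b \<ge> 2" and r: "r > 0" and u: "\<And>j. j \<in> {1..b} \<Longrightarrow> u j \<ge> 0"
    and v: "\<And>j. j \<in> {1..b} \<Longrightarrow> v j \<ge> r\<^sup>2"
  shows "\<bar>1 / (real b * (real b - 1)) * (\<Sum>(j, k)\<in>off_diagonal b. sqrt (u j + u k))
       - 1 / (real b * (real b - 1)) * (\<Sum>(j, k)\<in>off_diagonal b. sqrt (v j + v k))\<bar>
     \<le> 2 / (b * r) * (\<Sum>j\<in>{1..b}. \<bar>u j - v j\<bar>)"
proof -
  have b1: "real b - 1 > 0" "real b > 0" using b by auto
  have "\<bar>(\<Sum>(j, k)\<in>off_diagonal b. sqrt (u j + u k)) - (\<Sum>(j, k)\<in>off_diagonal b. sqrt (v j + v k))\<bar>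
      \<le> (\<Sum>(j, k)\<in>off_diagonal b. \<bar>sqrt (u j + u k) - sqrt (v j + v k)\<bar>)"
    unfolding sum_subtractf[symmetric] by (rule order_trans[OF sum_abs]) (simp add: case_prod_unfold)
  also have "\<dots> \<le> (\<Sum>(j, k)\<in>off_diagonal b. (\<bar>u j - v j\<bar> + \<bar>u k - v k\<bar>) / r)"
  proof (rule sum_mono, clarify)
    fix j k assume "(j, k) \<in> off_diagonal b"
    then have jk: "j \<in> {1..b}" "k \<in> {1..b}" by (auto simp: off_diagonal_def)
    have "\<bar>sqrt (u j + u k) - sqrt (v j + v k)\<bar> \<le> \<bar>(u j + u k) - (v j + v k)\<bar> / r"
      using u[OF jk(1)] u[OF jk(2)] v[OF jk(1)] order_trans[OF zero_le_power2 v[OF jk(2)]] r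
      by (intro abs_sqrt_diff_le) auto
    also have "\<dots> \<le> (\<bar>u j - v j\<bar> + \<bar>u k - v k\<bar>) / r"
      using r by (intro divide_right_mono) auto
    finally show "\<bar>sqrt (u j + u k) - sqrt (v j + v k)\<bar> \<le> (\<bar>u j - v j\<bar> + \<bar>u k - v k\<bar>) / r" .
  qed
  also have "\<dots> = 2 * (real b - 1) * (\<Sum>j\<in>{1..b}. \<bar>u j - v j\<bar>) / r"
    using sum_off_diagonal_fst_snd[of b "\<lambda>j. \<bar>u j - v j\<bar>"] b
    by (simp add: sum_divide_distrib[symmetric] case_prod_unfold)
  finally have *: "\<bar>(\<Sum>(j, k)\<in>off_diagonal b. sqrt (u j + u k)) - (\<Sum>(j, k)\<in>off_diagonal b. sqrt (v j + v k))\<bar>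
    \<le> 2 * (real b - 1) * (\<Sum>j\<in>{1..b}. \<bar>u j - v j\<bar>) / r" .
  have "1 / (real b * (real b - 1)) * \<bar>(\<Sum>(j, k)\<in>off_diagonal b. sqrt (u j + u k))
       - (\<Sum>(j, k)\<in>off_diagonal b. sqrt (v j + v k))\<bar>
      \<le> 1 / (real b * (real b - 1)) * (2 * (real b - 1) * (\<Sum>j\<in>{1..b}. \<bar>u j - v j\<bar>) / r)"
    using b1 by (intro mult_left_mono *) auto
  also have "\<dots> = 2 / (b * r) * (\<Sum>j\<in>{1..b}. \<bar>u j - v j\<bar>)"
  proof -
    have "1 / (real b * c) * (2 * c * S / r) = 2 / (b * r) * S" if "c > 0" for c S :: real
      using that by simp
    then show ?thesis using b1(1) .
  qed
  also have "1 / (real b * (real b - 1)) * \<bar>(\<Sum>(j, k)\<in>off_diagonal b. sqrt (u j + u k))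
       - (\<Sum>(j, k)\<in>off_diagonal b. sqrt (v j + v k))\<bar>
    = \<bar>1 / (real b * (real b - 1)) * (\<Sum>(j, k)\<in>off_diagonal b. sqrt (u j + u k))
       - 1 / (real b * (real b - 1)) * (\<Sum>(j, k)\<in>off_diagonal b. sqrt (v j + v k))\<bar>"
  proof -
    have scale: "c * \<bar>x - y\<bar> = \<bar>c * x - c * y\<bar>" if "c > 0" for c x y :: real
      using that by (simp add: right_diff_distrib[symmetric] abs_mult)
    show ?thesis by (rule scale) (use b1 in simp)
  qed
  finally show ?thesis .
qed

text \<open>With off-diagonal sum \<open>S\<close> and diagonal sum \<open>D\<close>, the difference
  equals \<open>S / (b\<^sup>2 * (b - 1)) - D / b\<^sup>2\<close>, a difference of two numbers
  between \<open>0\<close> and \<open>C / b\<close>.\<close>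

lemma pair_average_diagonal:
  fixes a :: "nat \<Rightarrow> nat \<Rightarrow> real"
  assumes b: "b \<ge> 2" and a: "\<And>j k. j \<in> {1..b} \<Longrightarrow> k \<in> {1..b} \<Longrightarrow> 0 \<le> a j k \<and> a j k \<le> C"
  shows "\<bar>1 / (real b * (real b - 1)) * (\<Sum>(j, k)\<in>off_diagonal b. a j k)
     - (\<Sum>j\<in>{1..b}. \<Sum>k\<in>{1..b}. a j k) / (real b)\<^sup>2\<bar> \<le> C / b"
proof -
  define S where "S = (\<Sum>(j, k)\<in>off_diagonal b. a j k)"
  define D where "D = (\<Sum>j\<in>{1..b}. a j j)"
  have b1: "real b - 1 > 0" "real b > 0" using b by auto
  have "(\<Sum>j\<in>{1..b}. \<Sum>k\<in>{1..b}. a j k) = (\<Sum>j\<in>{1..b}. a j j + (\<Sum>k\<in>{1..b} - {j}. a j k))"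
    by (intro sum.cong refl sum.remove) auto
  then have eq: "(\<Sum>j\<in>{1..b}. \<Sum>k\<in>{1..b}. a j k) = D + S"
    by (simp only: S_def D_def sum_off_diagonal sum.distrib)
  have S: "0 \<le> S" "S \<le> real b * (real b - 1) * C"
  proof -
    show "0 \<le> S" unfolding S_def using a by (intro sum_nonneg) (auto simp: off_diagonal_def)
    have "S \<le> (\<Sum>(j, k)\<in>off_diagonal b. C / 2 + C / 2)"
      unfolding S_def using a by (intro sum_mono) (auto simp: off_diagonal_def)
    also have "\<dots> = real b * (real b - 1) * C"
      using sum_off_diagonal_fst_snd[of b "\<lambda>_. C / 2"] b by (auto simp: algebra_simps)
    finally show "S \<le> real b * (real b - 1) * C" .
  qed
  have D: "0 \<le> D" "D \<le> b * C"
    unfolding D_def using a by (auto intro!: sum_nonneg sum_bounded_above[of "{1..b}", simplified])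
  have 1: "1 / (real b * (real b - 1)) * S - (D + S) / (real b)\<^sup>2
     = S / ((real b)\<^sup>2 * (real b - 1)) - D / (real b)\<^sup>2"
  proof -
    define c where "c = real b - 1"
    have c: "c > 0" "real b = c + 1" using b1 by (simp_all add: c_def)
    show ?thesis unfolding c_def[symmetric] unfolding c(2) using c(1)
      by (simp add: divide_simps power2_eq_square) (simp add: algebra_simps)
  qed
  have 2: "0 \<le> S / ((real b)\<^sup>2 * (real b - 1))" "S / ((real b)\<^sup>2 * (real b - 1)) \<le> C / b"
  proof -
    show "0 \<le> S / ((real b)\<^sup>2 * (real b - 1))" using S b1 by simp
    have "S / ((real b)\<^sup>2 * (real b - 1)) \<le> real b * (real b - 1) * C / ((real b)\<^sup>2 * (real b - 1))"
      using S b1 by (intro divide_right_mono) auto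
    also have "\<dots> = C / b" using b1 by (simp add: power2_eq_square)
    finally show "S / ((real b)\<^sup>2 * (real b - 1)) \<le> C / b" .
  qed
  have 3: "0 \<le> D / (real b)\<^sup>2" "D / (real b)\<^sup>2 \<le> C / b"
  proof -
    show "0 \<le> D / (real b)\<^sup>2" using D by simp
    have "D / (real b)\<^sup>2 \<le> b * C / (real b)\<^sup>2" using D by (intro divide_right_mono) auto
    also have "\<dots> = C / b" using b1 by (simp add: power2_eq_square)
    finally show "D / (real b)\<^sup>2 \<le> C / b" .
  qed
  show ?thesis unfolding S_def[symmetric] eq 1 using 2 3 by linarith
qed

lemma block_average_bounds:
  fixes f :: "nat \<Rightarrow> real"
  assumes l: "l \<ge> 1" and j: "j \<ge> 1"
    and f: "\<And>i. i \<in> {(j - 1) * l + 1..j * l} \<Longrightarrow> u \<le> f i \<and> f i \<le> v"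
  shows "u \<le> 1 / l * (\<Sum>i\<in>{(j - 1) * l + 1..j * l}. f i)"
    and "1 / l * (\<Sum>i\<in>{(j - 1) * l + 1..j * l}. f i) \<le> v"
proof -
  let ?I = "{(j - 1) * l + 1..j * l}"
  have "real l * u \<le> (\<Sum>i\<in>?I. f i)" "(\<Sum>i\<in>?I. f i) \<le> real l * v"
    using sum_bounded_below[of ?I u f] sum_bounded_above[of ?I f v] f unfolding card_block[OF j] by blast+
  then show "u \<le> 1 / l * (\<Sum>i\<in>?I. f i)" "1 / l * (\<Sum>i\<in>?I. f i) \<le> v"
    using l by (auto simp: field_simps)
qed

lemma block_point:
  assumes l: "l \<ge> 1" and j: "j \<in> {1..b}" and i: "i \<in> {(j - 1) * l + 1..j * l}"
  shows "real i / real (b * l) \<in> {(real j - 1) / b..real j / b}"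
proof -
  have b: "b \<ge> 1" using j by auto
  have "real ((j - 1) * l) \<le> real i" "real i \<le> real (j * l)" using i by (auto simp del: of_nat_mult)
  then have "(real j - 1) * l \<le> i" "i \<le> real j * l" using j by (auto simp: of_nat_diff)
  then have "(real j - 1) * l / real (b * l) \<le> i / real (b * l)"
    "i / real (b * l) \<le> real j * l / real (b * l)"
    by (intro divide_right_mono; simp)+
  moreover have "c * l / real (b * l) = c / b" for c :: real using l by simp
  ultimately show ?thesis by (metis atLeastAtMost_iff)
qed

text \<open>Two errors add up in \<open>K\<close>: that of the double Riemann sum and, as
  \<open>sqrt (2 * A\<^sup>2)\<close>, that of the missing diagonal. Both are uniform in
  \<open>l\<close>, because an average of values of \<open>\<sigma>\<^sup>2\<close> on a block stays
  within their range, however many values are averaged.\<close>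

lemma deterministic_error:
  fixes \<sigma> :: "real \<Rightarrow> real"
  assumes pl: "piecewise_lipschitz01 \<sigma>" and r: "r > 0" "\<And>x. x \<in> {0..1} \<Longrightarrow> \<sigma> x \<ge> r"
  defines "v \<equiv> \<lambda>b l j. 1 / real l * (\<Sum>i\<in>{(j - 1) * l + 1..j * l}. (\<sigma> (real i / real (b * l)))\<^sup>2)"
  obtains K where "\<And>b l. b \<ge> 2 \<Longrightarrow> l \<ge> 1 \<Longrightarrow>
    \<bar>1 / (real b * (real b - 1)) * (\<Sum>(j, k)\<in>off_diagonal b. sqrt (v b l j + v b l k))
      - (LBINT x:{0..1}. LBINT y:{0..1}. sqrt ((\<sigma> x)\<^sup>2 + (\<sigma> y)\<^sup>2))\<bar> \<le> K / b"
    "\<And>b l j. l \<ge> 1 \<Longrightarrow> j \<in> {1..b} \<Longrightarrow> r\<^sup>2 \<le> v b l j"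
proof -
  obtain A L T where A: "A \<ge> 0" and L: "L \<ge> 0" and T: "finite T"
    and bd: "\<And>x. x \<in> {0..1} \<Longrightarrow> \<bar>\<sigma> x\<bar> \<le> A"
    and lip: "\<And>x y. x \<in> {0..1} \<Longrightarrow> y \<in> {0..1} \<Longrightarrow> x \<le> y \<Longrightarrow> {x..y} \<inter> T = {} \<Longrightarrow> \<bar>\<sigma> x - \<sigma> y\<bar> \<le> L * (y - x)"
    using piecewise_lipschitz01E[OF pl] by metis
  have bd2: "r\<^sup>2 \<le> (\<sigma> x)\<^sup>2 \<and> (\<sigma> x)\<^sup>2 \<le> A\<^sup>2" if "x \<in> {0..1}" for x
    using bd[OF that] r(2)[OF that] r(1) by (auto intro!: power_mono)
  have lip2: "\<bar>(\<sigma> x)\<^sup>2 - (\<sigma> y)\<^sup>2\<bar> \<le> 2 * A * L * (y - x)"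
    if xy: "x \<in> {0..1}" "y \<in> {0..1}" "x \<le> y" "{x..y} \<inter> T = {}" for x y
  proof -
    have "\<bar>(\<sigma> x)\<^sup>2 - (\<sigma> y)\<^sup>2\<bar> = \<bar>\<sigma> x + \<sigma> y\<bar> * \<bar>\<sigma> x - \<sigma> y\<bar>"
      by (simp add: abs_mult[symmetric] power2_eq_square algebra_simps)
    also have "\<dots> \<le> (A + A) * (L * (y - x))"
      using bd[OF xy(1)] bd[OF xy(2)] lip[OF xy] A by (intro mult_mono) auto
    finally show ?thesis by simp
  qed
  define K where "K = 4 * (2 * A\<^sup>2 * card T + A * L) / r + sqrt (2 * A\<^sup>2)"
  have in01: "x \<in> {0..1}" if "j \<in> {1..b}" "x \<in> {(real j - 1) / b..real j / b}" for j x b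
  proof -
    have "0 \<le> (real j - 1) / b" "real j / b \<le> 1" using that(1) by auto
    then show ?thesis using that(2) by auto
  qed
  have v: "r\<^sup>2 \<le> v b l j" "v b l j \<le> A\<^sup>2" if "l \<ge> 1" "j \<in> {1..b}" for b l j
    using block_average_bounds[OF that(1), of j "r\<^sup>2" "\<lambda>i. (\<sigma> (real i / real (b * l)))\<^sup>2" "A\<^sup>2"]
      bd2[OF in01[OF that(2) block_point[OF that]]] that(2) unfolding v_def by auto
  show ?thesis
  proof (rule that[of K])
    fix b l :: nat assume b: "b \<ge> 2" and l: "l \<ge> 1"
    define J where "J = {j \<in> {1..b}. {(real j - 1) / b..real j / b} \<inter> T \<noteq> {}}"
    \<comment> \<open>On a block with a jump, both numbers lie in \<open>[0, A\<^sup>2]\<close>, so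
      \<open>A\<^sup>2\<close> bounds their distance. On any other block the Lipschitz constant
      \<open>2 * A * L\<close> of \<open>\<sigma>\<^sup>2\<close> is applied to an interval of
      length \<open>1 / b\<close>.\<close>
    define e where "e j = (if j \<in> J then A\<^sup>2 else 2 * A * L / b)" for j
    have b1: "b \<ge> 1" using b by simp
    have e: "\<bar>(\<sigma> x)\<^sup>2 - v b l j\<bar> \<le> e j"
      if j: "j \<in> {1..b}" and x: "x \<in> {(real j - 1) / b..real j / b}" for j x
    proof (cases "j \<in> J")
      case True
      have "0 \<le> v b l j" by (rule order_trans[OF zero_le_power2 v(1)[OF l j]])
      moreover have "\<bar>p - q\<bar> \<le> A\<^sup>2" if "0 \<le> p" "p \<le> A\<^sup>2" "0 \<le> q" "q \<le> A\<^sup>2" for p q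
        using that by linarith
      ultimately have "\<bar>(\<sigma> x)\<^sup>2 - v b l j\<bar> \<le> A\<^sup>2"
        using bd2[OF in01[OF j x]] v(2)[OF l j] zero_le_power2 by blast
      then show ?thesis using True by (simp add: e_def)
    next
      case False
      have near: "\<bar>(\<sigma> x)\<^sup>2 - (\<sigma> y)\<^sup>2\<bar> \<le> 2 * A * L / b"
        if y: "y \<in> {(real j - 1) / b..real j / b}" for y
      proof -
        have "\<bar>x - y\<bar> \<le> real j / b - (real j - 1) / b" using x y by auto
        also have "\<dots> = 1 / b" by (simp add: diff_divide_distrib)
        finally have xy: "2 * A * L * \<bar>x - y\<bar> \<le> 2 * A * L / b"
          using mult_left_mono[of "\<bar>x - y\<bar>" "1 / b" "2 * A * L"] A L by simp
        have *: "{s..t} \<inter> T = {}"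
          if "s \<in> {(real j - 1) / b..real j / b}" "t \<in> {(real j - 1) / b..real j / b}" for s t
        proof -
          have "{s..t} \<subseteq> {(real j - 1) / b..real j / b}" using that by auto
          then show ?thesis using False j unfolding J_def by blast
        qed
        note x01 = in01[OF j x] and y01 = in01[OF j y]
        show ?thesis
        proof (cases "x \<le> y")
          case True
          then show ?thesis using lip2[OF x01 y01 True *[OF x y]] xy by simp
        next
          case False
          then show ?thesis using lip2[OF y01 x01 _ *[OF y x]] xy by (simp add: abs_minus_commute)
        qed
      qed
      have range: "(\<sigma> x)\<^sup>2 - 2 * A * L / b \<le> (\<sigma> (real i / real (b * l)))\<^sup>2
          \<and> (\<sigma> (real i / real (b * l)))\<^sup>2 \<le> (\<sigma> x)\<^sup>2 + 2 * A * L / b"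
        if "i \<in> {(j - 1) * l + 1..j * l}" for i
        using near[OF block_point[OF l j that]] by linarith
      have "(\<sigma> x)\<^sup>2 - 2 * A * L / b \<le> v b l j" "v b l j \<le> (\<sigma> x)\<^sup>2 + 2 * A * L / b"
        using block_average_bounds[OF l _ range] j unfolding v_def by auto
      then show ?thesis using False by (simp add: e_def abs_le_iff)
    qed
    \<comment> \<open>The sum stays bounded as \<open>b\<close> grows: at most
      \<open>2 * card T\<close> blocks are charged \<open>A\<^sup>2\<close>, and the charge
      \<open>2 * A * L / b\<close> is counted \<open>b\<close> times. Dividing by \<open>b\<close>
      gives the rate.\<close>
    have sum_e: "(\<Sum>j\<in>{1..b}. e j) \<le> 2 * A\<^sup>2 * card T + 2 * A * L"
    proof -
      have "(\<Sum>j\<in>{1..b}. e j) \<le> (\<Sum>j\<in>{1..b}. A\<^sup>2 * indicator J j + 2 * A * L / b)"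
        unfolding e_def using A L by (intro sum_mono) (auto simp: indicator_def)
      also have "\<dots> = A\<^sup>2 * card J + 2 * A * L"
        using b by (simp add: sum.distrib sum_distrib_left[symmetric] J_def indicator_def Int_def)
      also have "\<dots> \<le> A\<^sup>2 * real (2 * card T) + 2 * A * L"
        using card_jump_blocks[OF T b1] unfolding J_def
        by (intro add_right_mono mult_left_mono) (auto simp del: of_nat_mult)
      finally show ?thesis by simp
    qed
    have qm: "(\<lambda>x. indicator {0..1} x * (\<sigma> x)\<^sup>2) \<in> borel_measurable borel"
    proof -
      note [measurable] = piecewise_lipschitz01_measurable[OF pl]
      have "(\<lambda>x. indicator {0..1} x * (\<sigma> x)\<^sup>2) = (\<lambda>x. (indicator {0..1} x * \<sigma> x)\<^sup>2)"
        by (auto simp: indicator_def)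
      then show ?thesis by simp
    qed
    have q: "0 \<le> (\<sigma> x)\<^sup>2 \<and> (\<sigma> x)\<^sup>2 \<le> A\<^sup>2" if "x \<in> {0..1}" for x using bd2[OF that] by simp
    have dbl: "\<bar>(LBINT x:{0..1}. LBINT y:{0..1}. sqrt ((\<sigma> x)\<^sup>2 + (\<sigma> y)\<^sup>2))
      - (\<Sum>j\<in>{1..b}. \<Sum>k\<in>{1..b}. sqrt (v b l j + v b l k)) / (real b)\<^sup>2\<bar>
     \<le> 2 * (\<Sum>j\<in>{1..b}. e j) / (b * r)"
      by (rule block_double_integral_error[OF b1 r(1) q qm v(1)[OF l] e])
    have a: "0 \<le> sqrt (v b l j + v b l k) \<and> sqrt (v b l j + v b l k) \<le> sqrt (2 * A\<^sup>2)"
      if jk: "j \<in> {1..b}" "k \<in> {1..b}" for j k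
      using v[OF l jk(1)] v[OF l jk(2)] order_trans[OF zero_le_power2 v(1)[OF l jk(1)]]
        order_trans[OF zero_le_power2 v(1)[OF l jk(2)]] by simp
    have diag: "\<bar>1 / (real b * (real b - 1)) * (\<Sum>(j, k)\<in>off_diagonal b. sqrt (v b l j + v b l k))
     - (\<Sum>j\<in>{1..b}. \<Sum>k\<in>{1..b}. sqrt (v b l j + v b l k)) / (real b)\<^sup>2\<bar> \<le> sqrt (2 * A\<^sup>2) / b"
      by (rule pair_average_diagonal[OF b a])
    have "2 * (\<Sum>j\<in>{1..b}. e j) / (b * r) \<le> 2 * (2 * A\<^sup>2 * card T + 2 * A * L) / (b * r)"
      using sum_e r b by (intro divide_right_mono mult_left_mono) auto
    also have "\<dots> \<le> 4 * (2 * A\<^sup>2 * card T + A * L) / (b * r)"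
      using A L r by (intro divide_right_mono) (auto simp: algebra_simps)
    also have "\<dots> = (4 * (2 * A\<^sup>2 * card T + A * L) / r) / b" by simp
    finally have e2: "2 * (\<Sum>j\<in>{1..b}. e j) / (b * r) \<le> (4 * (2 * A\<^sup>2 * card T + A * L) / r) / b" .
    have "K / b = (4 * (2 * A\<^sup>2 * card T + A * L) / r) / b + sqrt (2 * A\<^sup>2) / b"
      unfolding K_def by (rule add_divide_distrib)
    with dbl diag e2 show "\<bar>1 / (real b * (real b - 1)) * (\<Sum>(j, k)\<in>off_diagonal b. sqrt (v b l j + v b l k))
      - (LBINT x:{0..1}. LBINT y:{0..1}. sqrt ((\<sigma> x)\<^sup>2 + (\<sigma> y)\<^sup>2))\<bar> \<le> K / b"
      by linarith
  qed (rule v(1))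
qed

text \<open>The value at the right end point is not determined: cadlag functions on \<open>[0,1]\<close> need not be
  left continuous at \<open>1\<close>.\<close>

lemma cadlag01_AE_const:
  assumes "cadlag01 \<mu>" and ae: "AE x in lborel. x \<in> {0..1} \<longrightarrow> \<mu> x = m" and x: "x \<in> {0..<1}"
  shows "\<mu> x = m"
proof (rule ccontr)
  assume "\<mu> x \<noteq> m"
  have "(\<mu> \<longlongrightarrow> \<mu> x) (at_right x)" using assms(1) x unfolding cadlag01_def by blast
  then have "\<forall>\<^sub>F y in at_right x. \<mu> y \<noteq> m" using \<open>\<mu> x \<noteq> m\<close> by (rule tendsto_imp_eventually_ne)
  then obtain d where d: "d > x" "\<And>y. x < y \<Longrightarrow> y < d \<Longrightarrow> \<mu> y \<noteq> m"
    unfolding eventually_at_right_field by blast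
  \<comment> \<open>The cut at \<open>1\<close> keeps the interval inside \<open>[0,1]\<close>,
    where \<mu> is almost everywhere \<open>m\<close>. The interval would then be a null set of
    positive length.\<close>
  define z where "z = min d 1"
  have z: "x < z" using d x by (auto simp: z_def)
  have "AE y in lborel. y \<notin> {x<..<z}"
    using ae by eventually_elim (use d(2) x in \<open>auto simp: z_def\<close>)
  moreover have "{y \<in> space lborel. \<not> y \<notin> {x<..<z}} = {x<..<z}" by auto
  ultimately have "emeasure lborel {x<..<z} = 0" using AE_iff_measurable[of "{x<..<z}" lborel] by simp
  then show False using z by simp
qed

lemma local_var_cong:
  assumes "\<And>i. i \<in> {(j - 1) * l + 1..j * l} \<Longrightarrow> x i = y i"
  shows "local_var l x j = local_var l y j"
proof -
  have "local_mean l x j = local_mean l y j" using assms by (simp add: local_mean_def)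
  then show ?thesis using assms by (simp add: local_var_def)
qed

section \<open>Convergence of the pair statistic\<close>

lemma powr_le_one_plus_powr:
  fixes x :: real
  assumes "0 \<le> x" "0 \<le> p" "p \<le> q"
  shows "x powr p \<le> 1 + x powr q"
proof (cases "x \<le> 1")
  case True
  then have "x powr p \<le> 1" using assms by (intro powr_le1) auto
  then show ?thesis using powr_ge_zero[of x q] by linarith
next
  case False
  then have "x powr p \<le> x powr q" using assms by (intro powr_mono) auto
  then show ?thesis by linarith
qed

text \<open>For \<open>y\<^sup>2 \<le> 1\<close> the left side is at most \<open>1\<close>;
  otherwise \<open>\<bar>y\<^sup>2 - 1\<bar> \<le> y\<^sup>2\<close>. With
  \<open>p = 2 + \<delta>\<close> it transfers the moment hypothesis on \<open>Y 1\<close> to its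
  centred square.\<close>

lemma abs_square_minus_one_powr_le:
  fixes y p :: real
  assumes "p > 0"
  shows "\<bar>y\<^sup>2 - 1\<bar> powr p \<le> 1 + \<bar>y\<bar> powr (2 * p)"
proof (cases "y\<^sup>2 \<le> 1")
  case True
  then have "\<bar>y\<^sup>2 - 1\<bar> powr p \<le> 1" using assms by (intro powr_le1) auto
  then show ?thesis using powr_ge_zero[of "\<bar>y\<bar>" "2 * p"] by linarith
next
  case False
  then have "\<bar>y\<^sup>2 - 1\<bar> powr p \<le> (y\<^sup>2) powr p" using assms by (intro powr_mono2) auto
  also have "(y\<^sup>2) powr p = \<bar>y\<bar> powr (2 * p)"
  proof -
    have "y\<^sup>2 = \<bar>y\<bar> powr 2" using False by (cases "y = 0") auto
    then show ?thesis by (simp only: powr_powr)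
  qed
  finally show ?thesis by linarith
qed

text \<open>The second-moment bound enters twice: for the identity with weights \<open>w i\<close>,
  and for the centred squares with weights \<open>(w i)\<^sup>2\<close>, whose bound
  \<open>A\<^sup>2\<close> leads to \<open>(A\<^sup>2)\<^sup>2\<close>. The constant is fixed before
  block, length, weights and perturbation are chosen, as averaging over blocks requires.\<close>

lemma (in prob_space) mixing_local_var_error:
  fixes Y :: "nat \<Rightarrow> 'a \<Rightarrow> real"
  assumes Y: "\<And>i. i \<ge> 1 \<Longrightarrow> Y i \<in> borel_measurable M"
    and st: "strictly_stationary M Y"
    and mean: "expectation (Y 1) = 0" and var: "covariance M (Y 1) (Y 1) = 1"
    and \<delta>: "\<delta> > 0"
    and sm: "summable (\<lambda>k. alpha_mix M Y (Suc k) powr (\<delta> / (2 + \<delta>)))"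
    and mom: "integrable M (\<lambda>\<omega>. \<bar>Y 1 \<omega>\<bar> powr (4 + 2 * \<delta>))"
    and A: "A \<ge> 0"
  obtains K where "\<And>l j m (w :: nat \<Rightarrow> real) d. l \<ge> 1 \<Longrightarrow> j \<ge> 1 \<Longrightarrow>
      (\<And>i. i \<in> {(j - 1) * l + 1..j * l} \<Longrightarrow> \<bar>w i\<bar> \<le> A) \<Longrightarrow> (\<Sum>i\<in>{(j - 1) * l + 1..j * l}. \<bar>d i\<bar>) \<le> D \<Longrightarrow>
      integrable M (\<lambda>\<omega>. local_var l (\<lambda>i. m + d i + w i * Y i \<omega>) j) \<and>
      expectation (\<lambda>\<omega>. \<bar>local_var l (\<lambda>i. m + d i + w i * Y i \<omega>) j
         - 1 / l * (\<Sum>i\<in>{(j - 1) * l + 1..j * l}. (w i)\<^sup>2)\<bar>) \<le> K / sqrt l"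
proof -
  note Y1 [measurable] = Y[OF order_refl] Y[OF order_refl, simplified]
  have i2\<delta>: "integrable M (\<lambda>\<omega>. \<bar>Y 1 \<omega>\<bar> powr (2 + \<delta>))"
    by (rule Bochner_Integration.integrable_bound[where f = "\<lambda>\<omega>. 1 + \<bar>Y 1 \<omega>\<bar> powr (4 + 2 * \<delta>)"])
      (use mom \<delta> powr_le_one_plus_powr[of "\<bar>Y 1 _\<bar>" "2 + \<delta>" "4 + 2 * \<delta>"] in auto)
  have iq: "integrable M (\<lambda>\<omega>. \<bar>(Y 1 \<omega>)\<^sup>2 - 1\<bar> powr (2 + \<delta>))"
    by (rule Bochner_Integration.integrable_bound[where f = "\<lambda>\<omega>. 1 + \<bar>Y 1 \<omega>\<bar> powr (4 + 2 * \<delta>)"])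
      (use mom \<delta> abs_square_minus_one_powr_le[of "2 + \<delta>" "Y 1 _"] in auto)
  have i1: "integrable M (Y 1)" and i2: "integrable M (\<lambda>\<omega>. (Y 1 \<omega>)\<^sup>2)"
    using integrable_of_powr[OF Y1(1) i2\<delta>] \<delta> by auto
  have "expectation (\<lambda>\<omega>. (Y 1 \<omega>)\<^sup>2) = 1"
    using var mean by (simp add: covariance_def power2_eq_square)
  then have meanq: "expectation (\<lambda>\<omega>. (Y 1 \<omega>)\<^sup>2 - 1) = 0" using i2 by (simp add: prob_space)
  have idm: "(\<lambda>y::real. y) \<in> borel_measurable borel" by simp
  obtain C1 where C1: "C1 \<ge> 0"
    "\<And>I w A. finite I \<Longrightarrow> I \<subseteq> {1..} \<Longrightarrow> (\<And>i. i \<in> I \<Longrightarrow> \<bar>w i\<bar> \<le> A) \<Longrightarrow> A \<ge> 0 \<Longrightarrow>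
        integrable M (\<lambda>\<omega>. (\<Sum>i\<in>I. w i * Y i \<omega>)\<^sup>2)"
    "\<And>I w A. finite I \<Longrightarrow> I \<subseteq> {1..} \<Longrightarrow> (\<And>i. i \<in> I \<Longrightarrow> \<bar>w i\<bar> \<le> A) \<Longrightarrow> A \<ge> 0 \<Longrightarrow>
        expectation (\<lambda>\<omega>. (\<Sum>i\<in>I. w i * Y i \<omega>)\<^sup>2) \<le> C1 * A\<^sup>2 * card I"
  proof (rule mixing_sum_second_moment[OF _ st idm \<delta> sm i2\<delta> mean], goal_cases)
    case (1 i)
    from 1(2) show ?case by (rule Y)
  next
    case (2 C)
    show ?case by (rule 2(1)) (fact 2)+
  qed
  have qm: "(\<lambda>y::real. y\<^sup>2 - 1) \<in> borel_measurable borel" by measurable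
  obtain C2 where C2: "C2 \<ge> 0"
    "\<And>I w A. finite I \<Longrightarrow> I \<subseteq> {1..} \<Longrightarrow> (\<And>i. i \<in> I \<Longrightarrow> \<bar>w i\<bar> \<le> A) \<Longrightarrow> A \<ge> 0 \<Longrightarrow>
        integrable M (\<lambda>\<omega>. (\<Sum>i\<in>I. w i * ((Y i \<omega>)\<^sup>2 - 1))\<^sup>2)"
    "\<And>I w A. finite I \<Longrightarrow> I \<subseteq> {1..} \<Longrightarrow> (\<And>i. i \<in> I \<Longrightarrow> \<bar>w i\<bar> \<le> A) \<Longrightarrow> A \<ge> 0 \<Longrightarrow>
        expectation (\<lambda>\<omega>. (\<Sum>i\<in>I. w i * ((Y i \<omega>)\<^sup>2 - 1))\<^sup>2) \<le> C2 * A\<^sup>2 * card I"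
  proof (rule mixing_sum_second_moment[OF _ st qm \<delta> sm iq meanq], goal_cases)
    case (1 i)
    from 1(2) show ?case by (rule Y)
  next
    case (2 C)
    show ?case by (rule 2(1)) (fact 2)+
  qed
  let ?m1 = "expectation (\<lambda>\<omega>. \<bar>Y 1 \<omega>\<bar>)"
  have m1: "?m1 \<ge> 0" by (rule integral_nonneg_AE) auto
  show ?thesis
  proof (rule that[of "(C2 * (A\<^sup>2)\<^sup>2 + 1) / 2 + 2 * A * D * ?m1 + 3 * D\<^sup>2 + 2 * C1 * A\<^sup>2"])
    fix l j :: nat and m :: real and w d :: "nat \<Rightarrow> real"
    let ?I = "{(j - 1) * l + 1..j * l}"
    assume l: "l \<ge> 1" and j: "j \<ge> 1" and w: "\<And>i. i \<in> ?I \<Longrightarrow> \<bar>w i\<bar> \<le> A"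
      and d: "(\<Sum>i\<in>?I. \<bar>d i\<bar>) \<le> D"
    have ge: "i \<ge> 1" if "i \<in> ?I" for i using that by auto
    have I: "finite ?I" "?I \<subseteq> {1..}" by auto
    have w2: "\<bar>(w i)\<^sup>2\<bar> \<le> A\<^sup>2" if "i \<in> ?I" for i
      using power_mono[OF w[OF that] abs_ge_zero, of 2] by simp
    have iY: "integrable M (Y i)" "expectation (\<lambda>\<omega>. \<bar>Y i \<omega>\<bar>) \<le> ?m1" "integrable M (\<lambda>\<omega>. (Y i \<omega>)\<^sup>2)"
      if "i \<in> ?I" for i
      using stationary_expectation[OF st Y ge[OF that], of "\<lambda>x. x"] i1
        stationary_expectation[OF st Y ge[OF that], of abs]
        stationary_expectation[OF st Y ge[OF that], of "\<lambda>x. x\<^sup>2"] i2 by auto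
    note c = card_block[OF j, of l]
    note * = local_var_error_expectation[OF l j w d A Y[OF ge] iY(1) iY(2) iY(3) 
      C1(2)[OF I w A] C1(3)[OF I w A, unfolded c] C2(2)[OF I w2 zero_le_power2] C2(3)[OF I w2 zero_le_power2, unfolded c]
      m1 C1(1), of "\<lambda>i. i" m]
    show "integrable M (\<lambda>\<omega>. local_var l (\<lambda>i. m + d i + w i * Y i \<omega>) j) \<and>
      expectation (\<lambda>\<omega>. \<bar>local_var l (\<lambda>i. m + d i + w i * Y i \<omega>) j - 1 / l * (\<Sum>i\<in>?I. (w i)\<^sup>2)\<bar>)
      \<le> ((C2 * (A\<^sup>2)\<^sup>2 + 1) / 2 + 2 * A * D * ?m1 + 3 * D\<^sup>2 + 2 * C1 * A\<^sup>2) / sqrt l"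
      using * by blast
  qed
qed

text \<open>No relation between \<open>b\<close> and \<open>l\<close> is imposed: the random error
  is bounded through \<open>l\<close> alone and the deterministic one through \<open>b\<close>
  alone. The constant \<open>2 * K / r\<close> combines the factor \<open>2 / r\<close> of the pair
  average with the rate constant \<open>K\<close> of a local variance.\<close>

lemma (in prob_space) pair_stat_error:
  fixes Y :: "nat \<Rightarrow> 'a \<Rightarrow> real" and \<mu> \<sigma> :: "real \<Rightarrow> real"
  assumes Y: "\<And>i. i \<ge> 1 \<Longrightarrow> Y i \<in> borel_measurable M"
    and st: "strictly_stationary M Y"
    and mean: "expectation (Y 1) = 0" and var: "covariance M (Y 1) (Y 1) = 1"
    and \<delta>: "\<delta> > 0"
    and sm: "summable (\<lambda>k. alpha_mix M Y (Suc k) powr (\<delta> / (2 + \<delta>)))"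
    and mom: "integrable M (\<lambda>\<omega>. \<bar>Y 1 \<omega>\<bar> powr (4 + 2 * \<delta>))"
    and pl: "piecewise_lipschitz01 \<sigma>" and r: "r > 0" "\<And>x. x \<in> {0..1} \<Longrightarrow> \<sigma> x \<ge> r"
    and \<mu>: "\<And>x. x \<in> {0..<1} \<Longrightarrow> \<mu> x = m"
  defines "J \<equiv> LBINT x:{0..1}. LBINT y:{0..1}. sqrt ((\<sigma> x)\<^sup>2 + (\<sigma> y)\<^sup>2)"
  obtains K1 K2 where "\<And>b l. b \<ge> 2 \<Longrightarrow> l \<ge> 1 \<Longrightarrow>
      integrable M (\<lambda>\<omega>. \<bar>pair_stat b l (obs \<mu> \<sigma> Y (b * l) \<omega>) - J\<bar>) \<and>
      expectation (\<lambda>\<omega>. \<bar>pair_stat b l (obs \<mu> \<sigma> Y (b * l) \<omega>) - J\<bar>) \<le> K1 / sqrt l + K2 / b"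
proof -
  let ?B = "\<lambda>j l. {(j - 1) * l + 1..j * l}"
  define v where "v b l j = 1 / real l * (\<Sum>i\<in>?B j l. (\<sigma> (real i / real (b * l)))\<^sup>2)" for b l j :: nat
  obtain A where A: "A \<ge> 0" "\<And>x. x \<in> {0..1} \<Longrightarrow> \<bar>\<sigma> x\<bar> \<le> A"
    using piecewise_lipschitz01E[OF pl] by metis
  obtain K2 where K2: "\<And>b l. b \<ge> 2 \<Longrightarrow> l \<ge> 1 \<Longrightarrow>
    \<bar>1 / (real b * (real b - 1)) * (\<Sum>(j, k)\<in>off_diagonal b. sqrt (v b l j + v b l k)) - J\<bar> \<le> K2 / b"
    and v: "\<And>b l j. l \<ge> 1 \<Longrightarrow> j \<in> {1..b} \<Longrightarrow> r\<^sup>2 \<le> v b l j"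
    using deterministic_error[OF pl r] unfolding v_def J_def by blast
  define D where "D = \<bar>\<mu> 1 - m\<bar>"
  obtain K where K: "\<And>l j m (w :: nat \<Rightarrow> real) d. l \<ge> 1 \<Longrightarrow> j \<ge> 1 \<Longrightarrow>
      (\<And>i. i \<in> ?B j l \<Longrightarrow> \<bar>w i\<bar> \<le> A) \<Longrightarrow> (\<Sum>i\<in>?B j l. \<bar>d i\<bar>) \<le> D \<Longrightarrow>
      integrable M (\<lambda>\<omega>. local_var l (\<lambda>i. m + d i + w i * Y i \<omega>) j) \<and>
      expectation (\<lambda>\<omega>. \<bar>local_var l (\<lambda>i. m + d i + w i * Y i \<omega>) j - 1 / l * (\<Sum>i\<in>?B j l. (w i)\<^sup>2)\<bar>) \<le> K / sqrt l"
    using mixing_local_var_error[OF Y st mean var \<delta> sm mom A(1), of D] by blast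
  show ?thesis
  proof (rule that[of "2 * K / r" K2])
    fix b l :: nat assume b: "b \<ge> 2" and l: "l \<ge> 1"
    define n where "n = b * l"
    have n: "n \<ge> 1" using b l by (simp add: n_def)
    let ?V = "\<lambda>\<omega>. local_var l (obs \<mu> \<sigma> Y n \<omega>)"
    \<comment> \<open>Among the indices \<open>1, ..., n\<close> only \<open>i = n\<close> has its
      design point outside \<open>[0,1)\<close>, so only there can \<mu> differ from
      \<open>m\<close>. The perturbation thus sits in the last block, and its mass is at most
      \<open>D\<close> in every block.\<close>
    define d where "d i = (if i = n then \<mu> 1 - m else 0)" for i
    have V: "integrable M (\<lambda>\<omega>. ?V \<omega> j) \<and> expectation (\<lambda>\<omega>. \<bar>?V \<omega> j - v b l j\<bar>) \<le> K / sqrt l"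
      if j: "j \<in> {1..b}" for j
    proof -
      have jl: "j * l \<le> n" using j unfolding n_def by simp
      have "?V \<omega> j = local_var l (\<lambda>i. m + d i + \<sigma> (real i / real n) * Y i \<omega>) j" for \<omega>
      proof (rule local_var_cong)
        fix i assume i: "i \<in> ?B j l"
        then have "i \<le> n" using jl by auto
        then show "obs \<mu> \<sigma> Y n \<omega> i = m + d i + \<sigma> (real i / real n) * Y i \<omega>"
          using n \<mu>[of "real i / real n"] by (cases "i = n") (auto simp: obs_def d_def)
      qed
      moreover have "\<bar>\<sigma> (real i / real n)\<bar> \<le> A" if i: "i \<in> ?B j l" for i
      proof (rule A(2))
        have "i \<le> n" using i jl by auto
        then show "real i / real n \<in> {0..1}" by (auto simp: divide_le_eq)
      qed
      moreover have "(\<Sum>i\<in>?B j l. \<bar>d i\<bar>) \<le> D"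
      proof -
        have "(\<Sum>i\<in>?B j l. \<bar>d i\<bar>) = (\<Sum>i\<in>?B j l. if i = n then D else 0)"
          by (intro sum.cong) (auto simp: d_def D_def)
        then show ?thesis by (simp add: D_def)
      qed
      ultimately show ?thesis
        using K[of l j "\<lambda>i. \<sigma> (real i / real n)" d m] j l unfolding v_def n_def by auto
    qed
    let ?P = "\<lambda>\<omega>. pair_stat b l (obs \<mu> \<sigma> Y n \<omega>)"
    let ?c = "1 / (real b * (real b - 1))"
    have P: "?P \<omega> = ?c * (\<Sum>(j, k)\<in>off_diagonal b. sqrt (?V \<omega> j + ?V \<omega> k))" for \<omega>
      by (simp add: pair_stat_def off_diagonal_def)
    have P_meas: "?P \<in> borel_measurable M"
      unfolding P using borel_measurable_integrable[OF conjunct1[OF V]]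
      by (auto simp: case_prod_unfold off_diagonal_def intro!: borel_measurable_times borel_measurable_sum
          borel_measurable_const borel_measurable_add measurable_compose[OF _ borel_measurable_sqrt])
    let ?E = "\<lambda>\<omega>. 2 / (b * r) * (\<Sum>j\<in>{1..b}. \<bar>?V \<omega> j - v b l j\<bar>) + K2 / b"
    have le: "\<bar>?P \<omega> - J\<bar> \<le> ?E \<omega>" for \<omega>
      using pair_average_lipschitz[OF b r(1), of "?V \<omega>" "v b l", OF local_var_nonneg v[OF l]]
        K2[OF b l] unfolding P by linarith
    have iV: "integrable M (\<lambda>\<omega>. \<bar>?V \<omega> j - v b l j\<bar>)" if "j \<in> {1..b}" for j
      using V[OF that] by simp
    have iE: "integrable M ?E"
      by (intro Bochner_Integration.integrable_add integrable_mult_right Bochner_Integration.integrable_sum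
          integrable_const iV)
    have iP: "integrable M (\<lambda>\<omega>. \<bar>?P \<omega> - J\<bar>)"
      by (rule Bochner_Integration.integrable_bound[OF iE])
        (use P_meas le in \<open>auto intro!: AE_I2 intro: order_trans[OF _ abs_ge_self]\<close>)
    have "expectation (\<lambda>\<omega>. \<bar>?P \<omega> - J\<bar>) \<le> expectation ?E"
      using iP iE le by (intro integral_mono) auto
    also have "\<dots> = 2 / (b * r) * (\<Sum>j\<in>{1..b}. expectation (\<lambda>\<omega>. \<bar>?V \<omega> j - v b l j\<bar>)) + K2 / b"
    proof -
      have lin: "expectation (\<lambda>\<omega>. c * S \<omega> + k) = c * expectation S + k" if "integrable M S" for S and c k :: real
        using that by (simp add: prob_space)
      show ?thesis
        by (subst lin) (simp_all only: iV Bochner_Integration.integral_sum Bochner_Integration.integrable_sum)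
    qed
    also have "\<dots> \<le> 2 / (b * r) * (\<Sum>j\<in>{1..b}. K / sqrt l) + K2 / b"
      using V r by (intro add_right_mono mult_left_mono sum_mono) auto
    also have "\<dots> = 2 * K / r / sqrt l + K2 / b" using b by simp
    finally show "integrable M (\<lambda>\<omega>. \<bar>pair_stat b l (obs \<mu> \<sigma> Y (b * l) \<omega>) - J\<bar>) \<and>
      expectation (\<lambda>\<omega>. \<bar>pair_stat b l (obs \<mu> \<sigma> Y (b * l) \<omega>) - J\<bar>) \<le> 2 * K / r / sqrt l + K2 / b"
      using iP unfolding n_def by simp
  qed
qed

text \<open>Integrality makes the floors exact, so the two powers of \<open>n\<close> multiply to
  \<open>n\<close> and the sample splits into complete blocks.\<close>

lemma admissible_blocks:
  assumes "n \<in> admissible s" "n \<ge> 1"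
  shows "real (block_length s n) = real n powr s" "real (block_number s n) = real n powr (1 - s)"
    "n = block_number s n * block_length s n"
proof -
  obtain k k' where k: "real n powr s = real k" "real n powr (1 - s) = real k'"
    using assms(1) unfolding admissible_def by (auto elim!: Nats_cases)
  show l: "real (block_length s n) = real n powr s"
    unfolding block_length_def k by simp
  show b: "real (block_number s n) = real n powr (1 - s)"
    unfolding block_number_def k by simp
  have "real (block_number s n * block_length s n) = real n"
    using assms by (simp add: l b powr_add[symmetric])
  then show "n = block_number s n * block_length s n" by linarith
qed

theorem proposition2p9:
  fixes M :: "'a measure" and Y :: "nat \<Rightarrow> 'a \<Rightarrow> real"
    and \<mu> \<sigma> :: "real \<Rightarrow> real" and \<sigma>\<^sub>0 s \<delta> :: real
  assumes "prob_space M"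
    and "\<And>i. i \<ge> 1 \<Longrightarrow> Y i \<in> borel_measurable M"
    and "strictly_stationary M Y"
    and "(\<integral>\<omega>. Y 1 \<omega> \<partial>M) = 0"
    and "covariance M (Y 1) (Y 1) = 1"
    and "alpha_mix M Y \<longlonglongrightarrow> 0"
    and "long_run_variance M Y > 0"
    and "cadlag01 \<mu>"
    and "cadlag01 \<sigma>"
    and "piecewise_lipschitz01 \<sigma>"
    and "\<sigma>\<^sub>0 > 0" and "\<And>x. x \<in> {0..1} \<Longrightarrow> \<sigma> x \<ge> \<sigma>\<^sub>0"
    and "1/2 < s" and "s < 1"
    and "\<delta> > 0"
    and "summable (\<lambda>k. alpha_mix M Y (Suc k) powr (\<delta> / (2 + \<delta>)))"
    and "integrable M (\<lambda>\<omega>. \<bar>Y 1 \<omega>\<bar> powr (4 + 2 * \<delta>))"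
    and "\<exists>\<mu>\<^sub>H. AE x in lborel. x \<in> {0..1} \<longrightarrow> \<mu> x = \<mu>\<^sub>H"
  shows "tendsto_zero_L1 M
           (\<lambda>n \<omega>. sqrt (real (block_number s n)) *
              \<bar>pair_stat (block_number s n) (block_length s n) (obs \<mu> \<sigma> Y n \<omega>)
               - (LBINT x:{0..1}. LBINT y:{0..1}. sqrt ((\<sigma> x)\<^sup>2 + (\<sigma> y)\<^sup>2))\<bar>)
           (inf sequentially (principal (admissible s)))"
proof -
  interpret prob_space M by fact
  let ?J = "LBINT x:{0..1}. LBINT y:{0..1}. sqrt ((\<sigma> x)\<^sup>2 + (\<sigma> y)\<^sup>2)"
  let ?F = "inf sequentially (principal (admissible s))"
  let ?b = "block_number s" and ?l = "block_length s"
  obtain m where m: "\<And>x. x \<in> {0..<1} \<Longrightarrow> \<mu> x = m"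
    using cadlag01_AE_const[OF \<open>cadlag01 \<mu>\<close>] \<open>\<exists>\<mu>\<^sub>H. AE x in lborel. x \<in> {0..1} \<longrightarrow> \<mu> x = \<mu>\<^sub>H\<close> by blast
  obtain K1 K2 where K: "\<And>b l. b \<ge> 2 \<Longrightarrow> l \<ge> 1 \<Longrightarrow>
      integrable M (\<lambda>\<omega>. \<bar>pair_stat b l (obs \<mu> \<sigma> Y (b * l) \<omega>) - ?J\<bar>) \<and>
      expectation (\<lambda>\<omega>. \<bar>pair_stat b l (obs \<mu> \<sigma> Y (b * l) \<omega>) - ?J\<bar>) \<le> K1 / sqrt l + K2 / b"
  proof (rule pair_stat_error[where m = m and \<mu> = \<mu>, OF _ assms(3-5) assms(15-17,10,11)], goal_cases)
    case (1 i)
    from 1(2) show ?case by (rule assms(2))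
  next
    case (2 x)
    from 2(2) show ?case by (rule assms(12))
  next
    case (3 x)
    from 3(2) show ?case by (rule m)
  next
    case (4 K1 K2)
    show ?case by (rule 4(1)) (fact 4)+
  qed
  define Z where "Z n \<omega> = sqrt (real (?b n)) * \<bar>pair_stat (?b n) (?l n) (obs \<mu> \<sigma> Y n \<omega>) - ?J\<bar>" for n \<omega>
  \<comment> \<open>The exponents are \<open>(1 - s) / 2 - s / 2\<close>, from
    \<open>sqrt b / sqrt l\<close>, and \<open>(1 - s) / 2 - (1 - s)\<close>, from
    \<open>sqrt b / b\<close>; the first is negative because \<open>s > 1 / 2\<close>, the second
    because \<open>s < 1\<close>.\<close>
  define U where "U n = K1 * real n powr (1 / 2 - s) + K2 * real n powr ((s - 1) / 2)" for n :: nat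
  have lim: "(\<lambda>n. real n powr p) \<longlonglongrightarrow> 0" if "p < 0" for p
    by (rule tendsto_neg_powr[OF that filterlim_real_sequentially])
  \<comment> \<open>This forces \<open>b \<ge> 2\<close>, so that distinct pairs exist and
    \<open>b - 1\<close> is nonzero: \<open>b\<close> is \<open>n powr (1 - s)\<close>, and its
    product with a number below \<open>1 / 2\<close> equals \<open>1\<close>.\<close>
  have "\<forall>\<^sub>F n in sequentially. real n powr (s - 1) < 1 / 2"
    using assms(14) by (intro order_tendstoD(2)[OF lim]) auto
  moreover have "\<forall>\<^sub>F n in sequentially. n \<ge> (1::nat)" by (rule eventually_ge_at_top)
  ultimately have "\<forall>\<^sub>F n in sequentially. n \<in> admissible s \<longrightarrow>
      integrable M (Z n) \<and> expectation (\<lambda>\<omega>. \<bar>Z n \<omega>\<bar>) \<le> U n"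
  proof eventually_elim
    case (elim n)
    show ?case
    proof
      assume "n \<in> admissible s"
      note bl = admissible_blocks[OF this elim(2)]
      have n: "real n > 0" using elim(2) by simp
      have "real n powr (1 - s) * real n powr (s - 1) = 1" using n by (simp add: powr_add[symmetric])
      moreover have "real n powr (1 - s) * real n powr (s - 1) \<le> real n powr (1 - s) * (1 / 2)"
        using elim(1) by (intro mult_left_mono) auto
      ultimately have b2: "?b n \<ge> 2" using bl(2) by linarith
      have "real (?l n) > 0" unfolding bl(1) using n by simp
      then have l1: "?l n \<ge> 1" by simp
      note K' = K[OF b2 l1, folded bl(3)]
      have "expectation (\<lambda>\<omega>. \<bar>Z n \<omega>\<bar>)
          = sqrt (?b n) * expectation (\<lambda>\<omega>. \<bar>pair_stat (?b n) (?l n) (obs \<mu> \<sigma> Y n \<omega>) - ?J\<bar>)"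
        by (simp add: Z_def abs_mult)
      also have "\<dots> \<le> sqrt (?b n) * (K1 / sqrt (?l n) + K2 / ?b n)"
        using K' by (intro mult_left_mono) auto
      also have "\<dots> = U n"
      proof -
        have sq: "sqrt (real n powr p) = real n powr (p / 2)" for p
          using n by (simp add: powr_half_sqrt[symmetric] powr_powr)
        have "sqrt (?b n) / sqrt (?l n) = real n powr (1 / 2 - s)"
        proof -
          have "(1 - s) / 2 - s / 2 = 1 / 2 - s" by (simp add: field_simps)
          then show ?thesis unfolding bl(1,2) sq powr_diff[symmetric] by (simp only:)
        qed
        moreover have "sqrt (?b n) / ?b n = real n powr ((s - 1) / 2)"
        proof -
          have "(1 - s) / 2 - (1 - s) = (s - 1) / 2" by (simp add: field_simps)
          then show ?thesis unfolding bl(2) sq powr_diff[symmetric] by (simp only:)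
        qed
        moreover have "sqrt (?b n) * (K1 / sqrt (?l n) + K2 / ?b n)
            = K1 * (sqrt (?b n) / sqrt (?l n)) + K2 * (sqrt (?b n) / ?b n)"
          by (simp add: distrib_left mult_ac)
        ultimately show ?thesis unfolding U_def by simp
      qed
      finally show "integrable M (Z n) \<and> expectation (\<lambda>\<omega>. \<bar>Z n \<omega>\<bar>) \<le> U n"
        using K' unfolding Z_def by simp
    qed
  qed
  then have ev: "\<forall>\<^sub>F n in ?F. integrable M (Z n) \<and> expectation (\<lambda>\<omega>. \<bar>Z n \<omega>\<bar>) \<le> U n"
    by (simp add: eventually_inf_principal)
  have "U \<longlonglongrightarrow> K1 * 0 + K2 * 0"
    unfolding U_def using assms(13,14) by (intro tendsto_add tendsto_mult tendsto_const lim) auto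
  then have U: "(U \<longlongrightarrow> 0) ?F" by (auto intro: tendsto_mono[OF inf_le1])
  have "((\<lambda>n. expectation (\<lambda>\<omega>. \<bar>Z n \<omega>\<bar>)) \<longlongrightarrow> 0) ?F"
  proof (rule tendsto_sandwich[OF _ _ tendsto_const U])
    show "\<forall>\<^sub>F n in ?F. 0 \<le> expectation (\<lambda>\<omega>. \<bar>Z n \<omega>\<bar>)"
      by (rule always_eventually) (auto intro!: integral_nonneg_AE)
    show "\<forall>\<^sub>F n in ?F. expectation (\<lambda>\<omega>. \<bar>Z n \<omega>\<bar>) \<le> U n"
      using ev by eventually_elim simp
  qed
  moreover have "\<forall>\<^sub>F n in ?F. integrable M (Z n)" using ev by eventually_elim simp
  ultimately have "tendsto_zero_L1 M Z ?F" by (simp add: tendsto_zero_L1_def)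
  then show ?thesis by (simp add: Z_def[abs_def])
qed

end
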